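(* Let $E$ be a Brauer configuration and let $C$ be the associated Brauer graph. The groupoids $\Pi(E,E)$ and $\Pi(C,E)$ are isomorphic. Especially, if the Brauer configuration $E$ is connected, then the Brauer graph $C$ is also connected, and the fundamental groups of $E$ and $C$ are isomorphic.
   Context: Let $G=\langle g\rangle$ be a fixed infinite cyclic group. A fractional Brauer configuration (f-BC) is a quadruple $E=(E,P,L,d)$, where $E$ is a $G$-set, $P$ and $L$ are two partitions of $E$ (write $P(e)$, $L(e)$ for the classes containing $e\in E$), and $d:E\to\mathbb{Z}_{>0}$ is a function, such that: (f1) $L(e)\subseteq P(e)$ and $P(e)$ is a finite set for each $e\in E$; (f2) if $L(e_1)=L(e_2)$, then $P(g\cdot e_1)=P(g\cdot e_2)$; (f3) if $e_1,e_2$ belong to the same $G$-orbit, then $d(e_1)=d(e_2)$; (f4) $P(e_1)=P(e_2)$ if and only if $P(g^{d(e_1)}\cdot e_1)=P(g^{d(e_2)}\cdot e_2)$; (f5) $L(e_1)=L(e_2)$ if and only if $L(g^{d(e_1)}\cdot e_1)=L(g^{d(e_2)}\cdot e_2)$; (f6) the sequence $L(g^{d(e)-1}\cdot e)\cdots L(g\cdot e)L(e)$ is not a proper subsequence (block of consecutive terms) of $L(g^{d(h)-1}\cdot h)\cdots L(g\cdot h)L(h)$ for all $e,h\in E$. The vertices of $E$ are its $G$-orbits; the polygons are the sets $P(e)$ ($l$-gons if $|P(e)|=l$). The f-degree of a finite vertex $v$ is $d(v)/|v|$. A Brauer configuration is an f-BC with $E$ finite, $L(e)=\{e\}$ for all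 $e$, all f-degrees integers, and no $1$-gons. A Brauer graph is a Brauer configuration all of whose polygons are $2$-gons. A walk of $E$ is a sequence $w=(e_n|\delta_n|e_{n-1})\cdots(e_1|\delta_1|e_0)$ with $e_i\in E$, $\delta_i\in\{g,g^{-1},\tau\}$, such that $e_i=g\cdot e_{i-1}$ if $\delta_i=g$, $e_i=g^{-1}\cdot e_{i-1}$ if $\delta_i=g^{-1}$, $P(e_i)=P(e_{i-1})$ if $\delta_i=\tau$; abbreviated $(e_n|\delta_n\cdots\delta_1|e_0)$; $(e||e)$ is the trivial walk. Composition $uv$ is concatenation when the terminal of $v$ is the source of $u$. $E$ is connected if any two elements can be connected by a walk. Homotopy $\sim$ is the smallest equivalence relation on walks with: (h1) $(e|g^{-1}g|e)\sim(e|gg^{-1}|e)\sim(e|\tau|e)\sim(e||e)$; (h2) $(e_2|\tau|e_1)(e_1|\tau|e_0)\sim(e_2|\tau|e_0)$; (h3) $(g^{d(h)}\cdot h|\tau|g^{d(e)}\cdot e)(g^{d(e)}\cdot e|g^{d(e)}|e)\sim(g^{d(h)}\cdot h|g^{d(h)}|h)(h|\tau|e)$ whenever $P(e)=P(h)$; (h4) $(g\cdot h|\tau|g\cdot e)(g\cdot e|g|e)\sim(g\cdot h|g|h)(h|\tau|e)$ whenever $L(e)=L(h)$; (h5) compatibility with composition on both sides. For $A\subseteq E$, the fundamental groupoid $\Pi(E,A)$ has object set $A$ and morphisms from $x$ to $y$ the homotopy classes of walks of $E$ from $x$ to $y$; the fundamental group of a connected f-BC is the group of homotopy classes of closed walks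 at any fixed element (independent of the element up to isomorphism). The Brauer graph $C=(C,\widetilde{P},\widetilde{L},\widetilde{d})$ associated with a Brauer configuration $E=(E,P,L,d)$ (write $g(h)$ for the action of $g$ on $h\in E$): for each polygon of $E$ with $n\ge3$ elements, label its elements $e_1,\ldots,e_n$ and introduce new elements $e'_2,\ldots,e'_{n-1}$, the set of which is denoted $\overline{P(e)}$. As a set, $C=E\sqcup\bigsqcup_{|P(e)|\ge3}\overline{P(e)}$ (one set $\overline{P(e)}$ for each such polygon). The $G$-action on $C$ is: $g\cdot h=g(h)$ if $h\in E$ and $h'$ is not defined; $g\cdot h=h'$ if $h\in E$ and $h'$ is defined; $g\cdot e'=g(e)$ for $e\in E$ with $e'$ defined. $\widetilde{P}(h)=P(h)$ if $h\in E$ and $|P(h)|=2$; for a polygon $P(e)=\{e_1,\ldots,e_n\}$ with $n\ge3$, $P(e)\sqcup\overline{P(e)}$ is partitioned by $\widetilde{P}$ into $\{e_1,e_2\},\{e'_2,e_3\},\{e'_3,e_4\},\ldots,\{e'_{n-1},e_n\}$. $\widetilde{L}(h)=\{h\}$ for all $h\in C$. $\widetilde{d}(h)=d(h)\cdot|G\text{-orbit of }h\text{ in }C|\,/\,|G\text{-orbit of }h\text{ in }E|$ for $h\in E$, and $\widetilde{d}(e')=\widetilde{d}(e)$. *)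

theory Defs
  imports
    Complex_Main
    "HOL-Algebra.Group_Action"
    "HOL-Algebra.Elementary_Groups"
    "HOL-Library.Disjoint_Sets"
    "HOL-Library.Sublist"
begin

section \<open>Fractional Brauer configurations\<close>

text \<open>
  The fixed infinite cyclic group is \<open>integer_group\<close>, with generator \<open>g = 1\<close>; thus
  \<open>act E k e\<close> is \<open>g\<^sup>k \<cdot> e\<close>.  The partitions \<open>P\<close> and \<open>L\<close> are given by their sets of blocks.
\<close>

record 'a fbc =
  elems :: "'a set"
  act :: "int \<Rightarrow> 'a \<Rightarrow> 'a"
  polys :: "'a set set"
  lblocks :: "'a set set"
  deg :: "'a \<Rightarrow> nat"

definition block :: "'a set set \<Rightarrow> 'a \<Rightarrow> 'a set" where
  "block Q e = (THE X. X \<in> Q \<and> e \<in> X)"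

lemma block_eq:
  assumes "partition_on A Q" "X \<in> Q" "e \<in> X"
  shows "block Q e = X"
  unfolding block_def
proof (rule the_equality)
  show "X \<in> Q \<and> e \<in> X" using assms by simp
  show "Y = X" if "Y \<in> Q \<and> e \<in> Y" for Y
    using assms that by (auto simp: partition_on_def disjoint_def)
qed

definition pclass :: "'a fbc \<Rightarrow> 'a \<Rightarrow> 'a set" where
  "pclass E e = block (polys E) e"

definition lclass :: "'a fbc \<Rightarrow> 'a \<Rightarrow> 'a set" where
  "lclass E e = block (lblocks E) e"

definition gorbit :: "'a fbc \<Rightarrow> 'a \<Rightarrow> 'a set" where
  "gorbit E e = orbit integer_group (act E) e"

text \<open>\<open>full_turn E e\<close> is the element reached from \<open>e\<close> after \<open>d(e)\<close> steps of \<open>g\<close>.\<close>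

definition full_turn :: "'a fbc \<Rightarrow> 'a \<Rightarrow> 'a" where
  "full_turn E e = act E (int (deg E e)) e"

definition lseq :: "'a fbc \<Rightarrow> 'a \<Rightarrow> 'a set list" where
  "lseq E e = map (\<lambda>i. lclass E (act E (int i) e)) (rev [0..<deg E e])"

definition frac_brauer_config :: "'a fbc \<Rightarrow> bool" where
  "frac_brauer_config E \<longleftrightarrow>
     group_action integer_group (elems E) (act E) \<and>
     partition_on (elems E) (polys E) \<and>
     partition_on (elems E) (lblocks E) \<and>
     (\<forall>e\<in>elems E. 0 < deg E e) \<and>
     (\<forall>e\<in>elems E. lclass E e \<subseteq> pclass E e \<and> finite (pclass E e)) \<and>
     (\<forall>e1\<in>elems E. \<forall>e2\<in>elems E. lclass E e1 = lclass E e2 \<longrightarrow>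
        pclass E (act E 1 e1) = pclass E (act E 1 e2)) \<and>
     (\<forall>e1\<in>elems E. \<forall>e2\<in>gorbit E e1. deg E e1 = deg E e2) \<and>
     (\<forall>e1\<in>elems E. \<forall>e2\<in>elems E. pclass E e1 = pclass E e2 \<longleftrightarrow>
        pclass E (full_turn E e1) = pclass E (full_turn E e2)) \<and>
     (\<forall>e1\<in>elems E. \<forall>e2\<in>elems E. lclass E e1 = lclass E e2 \<longleftrightarrow>
        lclass E (full_turn E e1) = lclass E (full_turn E e2)) \<and>
     (\<forall>e\<in>elems E. \<forall>h\<in>elems E. \<not> strict_sublist (lseq E e) (lseq E h))"

definition f_degree :: "'a fbc \<Rightarrow> 'a \<Rightarrow> rat" where
  "f_degree E e = of_nat (deg E e) / of_nat (card (gorbit E e))"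

definition brauer_config :: "'a fbc \<Rightarrow> bool" where
  "brauer_config E \<longleftrightarrow>
     frac_brauer_config E \<and>
     finite (elems E) \<and>
     (\<forall>e\<in>elems E. lclass E e = {e}) \<and>
     (\<forall>e\<in>elems E. f_degree E e \<in> \<int>) \<and>
     (\<forall>X\<in>polys E. card X \<noteq> 1)"

definition brauer_graph :: "'a fbc \<Rightarrow> bool" where
  "brauer_graph E \<longleftrightarrow> brauer_config E \<and> (\<forall>X\<in>polys E. card X = 2)"


section \<open>Walks and homotopy\<close>

datatype letter = Gen | GenInv | Tau

text \<open>
  The walk \<open>(e\<^sub>n|\<delta>\<^sub>n|e\<^sub>n\<^sub>-\<^sub>1) \<dots> (e\<^sub>1|\<delta>\<^sub>1|e\<^sub>0)\<close> is the pair
  \<open>([(\<delta>\<^sub>n, e\<^sub>n), \<dots>, (\<delta>\<^sub>1, e\<^sub>1)], e\<^sub>0)\<close>; the trivial walk \<open>(e||e)\<close> is \<open>([], e)\<close>.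
\<close>

type_synonym 'a walk = "(letter \<times> 'a) list \<times> 'a"

definition source :: "'a walk \<Rightarrow> 'a" where
  "source w = snd w"

definition target :: "'a walk \<Rightarrow> 'a" where
  "target w = (case fst w of [] \<Rightarrow> snd w | (\<delta>, y) # _ \<Rightarrow> y)"

fun is_step :: "'a fbc \<Rightarrow> 'a \<Rightarrow> letter \<Rightarrow> 'a \<Rightarrow> bool" where
  "is_step E y Gen x \<longleftrightarrow> y = act E 1 x"
| "is_step E y GenInv x \<longleftrightarrow> y = act E (-1) x"
| "is_step E y Tau x \<longleftrightarrow> pclass E y = pclass E x"

fun is_walk :: "'a fbc \<Rightarrow> 'a walk \<Rightarrow> bool" where
  "is_walk E ([], x) \<longleftrightarrow> x \<in> elems E"
| "is_walk E ((\<delta>, y) # s, x) \<longleftrightarrow>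
     y \<in> elems E \<and> is_walk E (s, x) \<and> is_step E y \<delta> (target (s, x))"

text \<open>\<open>wcomp u v\<close> is the composite \<open>uv\<close> (first \<open>v\<close>, then \<open>u\<close>); it is meaningful when
  \<open>source u = target v\<close>.\<close>

definition wcomp :: "'a walk \<Rightarrow> 'a walk \<Rightarrow> 'a walk" where
  "wcomp u v = (fst u @ fst v, snd v)"

definition walks :: "'a fbc \<Rightarrow> 'a \<Rightarrow> 'a \<Rightarrow> 'a walk set" where
  "walks E x y = {w. is_walk E w \<and> source w = x \<and> target w = y}"

definition fbc_connected :: "'a fbc \<Rightarrow> bool" where
  "fbc_connected E \<longleftrightarrow> (\<forall>x\<in>elems E. \<forall>y\<in>elems E. walks E x y \<noteq> {})"

text \<open>The walk \<open>(g\<^sup>n \<cdot> e | g\<^sup>n | e)\<close>.\<close>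

definition gpow_walk :: "'a fbc \<Rightarrow> nat \<Rightarrow> 'a \<Rightarrow> 'a walk" where
  "gpow_walk E n e = (map (\<lambda>i. (Gen, act E (int i) e)) (rev [1..<Suc n]), e)"

definition tau_walk :: "'a \<Rightarrow> 'a \<Rightarrow> 'a walk" where
  "tau_walk y x = ([(Tau, y)], x)"

inductive homotopic :: "'a fbc \<Rightarrow> 'a walk \<Rightarrow> 'a walk \<Rightarrow> bool" for E where
  refl: "is_walk E w \<Longrightarrow> homotopic E w w"
| sym: "homotopic E u v \<Longrightarrow> homotopic E v u"
| trans: "homotopic E u v \<Longrightarrow> homotopic E v w \<Longrightarrow> homotopic E u w"
| h1_inv_gen: "e \<in> elems E \<Longrightarrow> homotopic E ([(GenInv, e), (Gen, act E 1 e)], e) ([], e)"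
| h1_gen_inv: "e \<in> elems E \<Longrightarrow> homotopic E ([(Gen, e), (GenInv, act E (-1) e)], e) ([], e)"
| h1_tau: "e \<in> elems E \<Longrightarrow> homotopic E (tau_walk e e) ([], e)"
| h2: "e0 \<in> elems E \<Longrightarrow> e1 \<in> elems E \<Longrightarrow> e2 \<in> elems E \<Longrightarrow>
       pclass E e1 = pclass E e0 \<Longrightarrow> pclass E e2 = pclass E e1 \<Longrightarrow>
       homotopic E (wcomp (tau_walk e2 e1) (tau_walk e1 e0)) (tau_walk e2 e0)"
| h3: "e \<in> elems E \<Longrightarrow> h \<in> elems E \<Longrightarrow> pclass E e = pclass E h \<Longrightarrow>
       homotopic E
         (wcomp (tau_walk (full_turn E h) (full_turn E e)) (gpow_walk E (deg E e) e))
         (wcomp (gpow_walk E (deg E h) h) (tau_walk h e))"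
| h4: "e \<in> elems E \<Longrightarrow> h \<in> elems E \<Longrightarrow> lclass E e = lclass E h \<Longrightarrow>
       homotopic E
         (wcomp (tau_walk (act E 1 h) (act E 1 e)) (gpow_walk E 1 e))
         (wcomp (gpow_walk E 1 h) (tau_walk h e))"
| h5_left: "homotopic E u v \<Longrightarrow> is_walk E w \<Longrightarrow>
       source w = target u \<Longrightarrow> source w = target v \<Longrightarrow>
       homotopic E (wcomp w u) (wcomp w v)"
| h5_right: "homotopic E u v \<Longrightarrow> is_walk E w \<Longrightarrow>
       source u = target w \<Longrightarrow> source v = target w \<Longrightarrow>
       homotopic E (wcomp u w) (wcomp v w)"

definition hclass :: "'a fbc \<Rightarrow> 'a walk \<Rightarrow> 'a walk set" where
  "hclass E w = {v. homotopic E w v}"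


section \<open>Groupoids and fundamental groups\<close>

record ('o, 'm) groupoid_data =
  obj :: "'o set"
  hom_set :: "'o \<Rightarrow> 'o \<Rightarrow> 'm set"
  cmp :: "'m \<Rightarrow> 'm \<Rightarrow> 'm"
  idt :: "'o \<Rightarrow> 'm"

text \<open>\<open>hom_set A x y\<close> is the set of morphisms from \<open>x\<close> to \<open>y\<close>, and \<open>cmp A f g\<close> is
  \<open>f\<close> after \<open>g\<close>.\<close>

definition is_groupoid :: "('o, 'm) groupoid_data \<Rightarrow> bool" where
  "is_groupoid A \<longleftrightarrow>
     (\<forall>x\<in>obj A. \<forall>y\<in>obj A. \<forall>x'\<in>obj A. \<forall>y'\<in>obj A.
        hom_set A x y \<inter> hom_set A x' y' \<noteq> {} \<longrightarrow> x = x' \<and> y = y') \<and>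
     (\<forall>x\<in>obj A. idt A x \<in> hom_set A x x) \<and>
     (\<forall>x\<in>obj A. \<forall>y\<in>obj A. \<forall>z\<in>obj A. \<forall>g\<in>hom_set A x y. \<forall>f\<in>hom_set A y z.
        cmp A f g \<in> hom_set A x z) \<and>
     (\<forall>w\<in>obj A. \<forall>x\<in>obj A. \<forall>y\<in>obj A. \<forall>z\<in>obj A.
        \<forall>h\<in>hom_set A w x. \<forall>g\<in>hom_set A x y. \<forall>f\<in>hom_set A y z.
        cmp A (cmp A f g) h = cmp A f (cmp A g h)) \<and>
     (\<forall>x\<in>obj A. \<forall>y\<in>obj A. \<forall>f\<in>hom_set A x y.
        cmp A f (idt A x) = f \<and> cmp A (idt A y) f = f \<and>
        (\<exists>g\<in>hom_set A y x. cmp A g f = idt A x \<and> cmp A f g = idt A y))"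

definition is_functor ::
  "('o, 'm) groupoid_data \<Rightarrow> ('p, 'n) groupoid_data \<Rightarrow> ('o \<Rightarrow> 'p) \<Rightarrow> ('m \<Rightarrow> 'n) \<Rightarrow> bool" where
  "is_functor A B Fo Fm \<longleftrightarrow>
     (\<forall>x\<in>obj A. Fo x \<in> obj B) \<and>
     (\<forall>x\<in>obj A. \<forall>y\<in>obj A. \<forall>f\<in>hom_set A x y. Fm f \<in> hom_set B (Fo x) (Fo y)) \<and>
     (\<forall>x\<in>obj A. Fm (idt A x) = idt B (Fo x)) \<and>
     (\<forall>x\<in>obj A. \<forall>y\<in>obj A. \<forall>z\<in>obj A. \<forall>g\<in>hom_set A x y. \<forall>f\<in>hom_set A y z.
        Fm (cmp A f g) = cmp B (Fm f) (Fm g))"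

definition isomorphic_groupoids ::
  "('o, 'm) groupoid_data \<Rightarrow> ('p, 'n) groupoid_data \<Rightarrow> bool" where
  "isomorphic_groupoids A B \<longleftrightarrow>
     (\<exists>Fo Fm Ko Km.
        is_functor A B Fo Fm \<and> is_functor B A Ko Km \<and>
        (\<forall>x\<in>obj A. Ko (Fo x) = x) \<and> (\<forall>y\<in>obj B. Fo (Ko y) = y) \<and>
        (\<forall>x\<in>obj A. \<forall>y\<in>obj A. \<forall>f\<in>hom_set A x y. Km (Fm f) = f) \<and>
        (\<forall>x\<in>obj B. \<forall>y\<in>obj B. \<forall>f\<in>hom_set B x y. Fm (Km f) = f))"

text \<open>Composite of two homotopy classes; for composable \<open>u\<close>, \<open>v\<close> it sends the classes of
  \<open>u\<close> and \<open>v\<close> to the class of \<open>uv\<close> (see \<open>hcomp_hclass\<close>).\<close>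

definition hcomp :: "'a fbc \<Rightarrow> 'a walk set \<Rightarrow> 'a walk set \<Rightarrow> 'a walk set" where
  "hcomp E U V = (\<Union>u\<in>U. \<Union>v\<in>V. hclass E (wcomp u v))"

definition fund_groupoid :: "'a fbc \<Rightarrow> 'a set \<Rightarrow> ('a, 'a walk set) groupoid_data" where
  "fund_groupoid E A =
     \<lparr>obj = A,
      hom_set = (\<lambda>x y. hclass E ` walks E x y),
      cmp = hcomp E,
      idt = (\<lambda>x. hclass E ([], x))\<rparr>"

definition fund_group :: "'a fbc \<Rightarrow> 'a \<Rightarrow> 'a walk set monoid" where
  "fund_group E x =
     \<lparr>carrier = hclass E ` walks E x x,
      monoid.mult = hcomp E,
      one = hclass E ([], x)\<rparr>"


section \<open>The Brauer graph associated with a Brauer configuration\<close>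

text \<open>
  The labelling \<open>e\<^sub>1, \<dots>, e\<^sub>n\<close> of a polygon \<open>X\<close> with \<open>n \<ge> 3\<close> elements is
  \<open>lab X 1, \<dots>, lab X n\<close>.  In the associated Brauer graph, \<open>Inl e\<close> is the old element
  \<open>e\<close> and \<open>Inr e\<close> is the new element \<open>e'\<close>.
\<close>

definition labelling :: "'a fbc \<Rightarrow> ('a set \<Rightarrow> nat \<Rightarrow> 'a) \<Rightarrow> bool" where
  "labelling E lab \<longleftrightarrow> (\<forall>X\<in>polys E. 3 \<le> card X \<longrightarrow> bij_betw (lab X) {1..card X} X)"

definition primed :: "'a fbc \<Rightarrow> ('a set \<Rightarrow> nat \<Rightarrow> 'a) \<Rightarrow> 'a set" where
  "primed E lab = (\<Union>X\<in>{X\<in>polys E. 3 \<le> card X}. lab X ` {2..card X - 1})"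

definition assoc_elems :: "'a fbc \<Rightarrow> ('a set \<Rightarrow> nat \<Rightarrow> 'a) \<Rightarrow> ('a + 'a) set" where
  "assoc_elems E lab = Inl ` elems E \<union> Inr ` primed E lab"

text \<open>The action of the generator, extensional on \<open>assoc_elems E lab\<close> as \<open>BijGroup\<close> requires.\<close>

definition assoc_gen :: "'a fbc \<Rightarrow> ('a set \<Rightarrow> nat \<Rightarrow> 'a) \<Rightarrow> 'a + 'a \<Rightarrow> 'a + 'a" where
  "assoc_gen E lab =
     (\<lambda>c\<in>assoc_elems E lab.
        case c of
          Inl h \<Rightarrow> if h \<in> primed E lab then Inr h else Inl (act E 1 h)
        | Inr e \<Rightarrow> Inl (act E 1 e))"

definition assoc_act :: "'a fbc \<Rightarrow> ('a set \<Rightarrow> nat \<Rightarrow> 'a) \<Rightarrow> int \<Rightarrow> 'a + 'a \<Rightarrow> 'a + 'a" where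
  "assoc_act E lab k = assoc_gen E lab [^]\<^bsub>BijGroup (assoc_elems E lab)\<^esub> k"

definition assoc_polys :: "'a fbc \<Rightarrow> ('a set \<Rightarrow> nat \<Rightarrow> 'a) \<Rightarrow> ('a + 'a) set set" where
  "assoc_polys E lab =
     {Inl ` X | X. X \<in> polys E \<and> card X = 2} \<union>
     {{Inl (lab X 1), Inl (lab X 2)} | X. X \<in> polys E \<and> 3 \<le> card X} \<union>
     {{Inr (lab X i), Inl (lab X (i + 1))} | X i.
        X \<in> polys E \<and> 3 \<le> card X \<and> i \<in> {2..card X - 1}}"

text \<open>The division is exact, because the f-degrees of a Brauer configuration are integers
  (see \<open>of_nat_assoc_deg\<close>).\<close>

definition assoc_deg :: "'a fbc \<Rightarrow> ('a set \<Rightarrow> nat \<Rightarrow> 'a) \<Rightarrow> 'a + 'a \<Rightarrow> nat" where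
  "assoc_deg E lab c =
     (let h = (case c of Inl h \<Rightarrow> h | Inr h \<Rightarrow> h)
      in deg E h * card (orbit integer_group (assoc_act E lab) (Inl h)) div card (gorbit E h))"

definition assoc_graph :: "'a fbc \<Rightarrow> ('a set \<Rightarrow> nat \<Rightarrow> 'a) \<Rightarrow> ('a + 'a) fbc" where
  "assoc_graph E lab =
     \<lparr>elems = assoc_elems E lab,
      act = assoc_act E lab,
      polys = assoc_polys E lab,
      lblocks = {{c} | c. c \<in> assoc_elems E lab},
      deg = assoc_deg E lab\<rparr>"


section \<open>The fundamental groupoid is a groupoid\<close>

lemma frac_dest:
  assumes "frac_brauer_config E"
  shows "group_action integer_group (elems E) (act E)"
    and "partition_on (elems E) (polys E)"
    and "partition_on (elems E) (lblocks E)"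
    and "\<forall>e\<in>elems E. 0 < deg E e"
    and "\<forall>e\<in>elems E. lclass E e \<subseteq> pclass E e \<and> finite (pclass E e)"
    and "\<forall>e1\<in>elems E. \<forall>e2\<in>elems E. lclass E e1 = lclass E e2 \<longrightarrow>
        pclass E (act E 1 e1) = pclass E (act E 1 e2)"
    and "\<forall>e1\<in>elems E. \<forall>e2\<in>gorbit E e1. deg E e1 = deg E e2"
    and "\<forall>e1\<in>elems E. \<forall>e2\<in>elems E. pclass E e1 = pclass E e2 \<longleftrightarrow>
        pclass E (full_turn E e1) = pclass E (full_turn E e2)"
  using assms unfolding frac_brauer_config_def by - (elim conjE, assumption)+

lemma act_closed:
  assumes "frac_brauer_config E" "e \<in> elems E"
  shows "act E k e \<in> elems E"
  using assms group_action.element_image[of integer_group "elems E" "act E" k e]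
  by (simp add: frac_dest)

lemma act_add:
  assumes "frac_brauer_config E" "e \<in> elems E"
  shows "act E (j + k) e = act E j (act E k e)"
  using assms group_action.composition_rule[of integer_group "elems E" "act E" e j k]
  by (simp add: frac_dest)

lemma act_zero:
  assumes "frac_brauer_config E" "e \<in> elems E"
  shows "act E 0 e = e"
  using assms group_action.id_eq_one[of integer_group "elems E" "act E"]
  by (simp add: frac_dest) (metis restrict_apply')

lemma act_inverse:
  assumes "frac_brauer_config E" "e \<in> elems E"
  shows "act E (-1) (act E 1 e) = e" "act E 1 (act E (-1) e) = e"
proof -
  have "act E (-1 + 1) e = e" "act E (1 + -1) e = e"
    using act_zero[OF assms] by simp_all
  then show "act E (-1) (act E 1 e) = e" "act E 1 (act E (-1) e) = e"
    unfolding act_add[OF assms] .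
qed

lemma target_append: "target (s @ t, x) = target (s, target (t, x))"
  by (cases s) (auto simp: target_def)

lemma target_simps [simp]: "target ([], x) = x" "target ((\<delta>, y) # s, x) = y"
  by (auto simp: target_def)

lemma source_simp [simp]: "source (s, x) = x"
  by (simp add: source_def)

lemma is_walk_append:
  "is_walk E (s @ t, x) \<longleftrightarrow> is_walk E (t, x) \<and> is_walk E (s, target (t, x))"
proof (induction s)
  case Nil
  have "is_walk E (t, x) \<Longrightarrow> target (t, x) \<in> elems E"
    by (induction t arbitrary: x) auto
  then show ?case by auto
next
  case (Cons a s)
  then show ?case by (cases a) (auto simp: target_append)
qed

lemma is_walk_ends:
  assumes "is_walk E w" shows "source w \<in> elems E" "target w \<in> elems E"
proof -
  have *: "is_walk E (s, x) \<Longrightarrow> x \<in> elems E \<and> target (s, x) \<in> elems E" for s x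
    by (induction s) auto
  show "source w \<in> elems E" "target w \<in> elems E"
    using * assms by (cases w; auto)+
qed

lemma is_walk_wcomp:
  "source u = target v \<Longrightarrow> is_walk E (wcomp u v) \<longleftrightarrow> is_walk E u \<and> is_walk E v"
  by (cases u; cases v) (auto simp: wcomp_def is_walk_append)

lemma source_wcomp [simp]: "source (wcomp u v) = source v"
  by (simp add: wcomp_def source_def)

lemma target_wcomp: "source u = target v \<Longrightarrow> target (wcomp u v) = target u"
  by (cases u; cases v) (simp add: wcomp_def target_append)

lemma wcomp_assoc: "wcomp (wcomp u v) w = wcomp u (wcomp v w)"
  by (simp add: wcomp_def)

lemma gpow_walk_walk:
  assumes "frac_brauer_config E" "e \<in> elems E"
  shows "is_walk E (gpow_walk E n e) \<and> source (gpow_walk E n e) = e \<and>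
    target (gpow_walk E n e) = act E (int n) e"
proof (induction n)
  case 0
  then show ?case using assms act_zero[OF assms] by (simp add: gpow_walk_def)
next
  case (Suc n)
  then show ?case using assms act_add[OF assms, of 1 "int n"] act_closed[OF assms(1) act_closed[OF assms]]
    by (simp add: gpow_walk_def)
qed

lemma homotopic_walks:
  assumes E: "frac_brauer_config E" and "homotopic E u v"
  shows "is_walk E u \<and> is_walk E v \<and> source u = source v \<and> target u = target v"
  using assms(2)
proof (induction rule: homotopic.induct)
  case (h3 e h)
  have "pclass E (full_turn E h) = pclass E (full_turn E e)"
    using frac_dest(8)[OF E] h3(1,2,3) by metis
  moreover have "full_turn E e \<in> elems E" "full_turn E h \<in> elems E"
    using act_closed[OF E] h3(1,2) by (auto simp: full_turn_def)
  ultimately show ?case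
    using gpow_walk_walk[OF E h3(1), of "deg E e"] gpow_walk_walk[OF E h3(2), of "deg E h"] 
      h3(1,2) h3(3)[symmetric]
    by (simp add: is_walk_wcomp target_wcomp tau_walk_def flip: full_turn_def)
next
  case (h4 e h)
  have "pclass E (act E 1 h) = pclass E (act E 1 e)"
    using frac_dest(6)[OF E] h4(1,2,3) by metis
  moreover have "act E 1 e \<in> elems E" "act E 1 h \<in> elems E"
    using act_closed[OF E] h4(1,2) by auto
  moreover have "pclass E h = pclass E e"
  proof -
    note P = frac_dest(2)[OF E] and L = frac_dest(3)[OF E]
    obtain Y where "Y \<in> lblocks E" "h \<in> Y" using h4(2) L by (auto simp: partition_on_def)
    hence "h \<in> lclass E h" using block_eq[OF L, of Y h] by (simp add: lclass_def)
    hence "h \<in> pclass E e" using frac_dest(5)[OF E] h4(1,3) by blast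
    moreover obtain X where "X \<in> polys E" "e \<in> X" using h4(1) P by (auto simp: partition_on_def)
    ultimately show ?thesis using block_eq[OF P, of X] by (simp add: pclass_def)
  qed
  ultimately show ?case
    using gpow_walk_walk[OF E h4(1), of 1] gpow_walk_walk[OF E h4(2), of 1] h4(1,2)
    by (simp add: is_walk_wcomp target_wcomp tau_walk_def)
next
  case (h1_inv_gen e)
  then show ?case
    using act_closed[OF E, of e] act_inverse[OF E, of e] by simp
next
  case (h1_gen_inv e)
  then show ?case
    using act_closed[OF E, of e] act_inverse[OF E, of e] by simp
next
  case (h5_left u v w)
  then show ?case by (simp add: is_walk_wcomp target_wcomp)
next
  case (h5_right u v w)
  then show ?case by (simp add: is_walk_wcomp target_wcomp)
next
  case (h2 e0 e1 e2)
  then show ?case by (simp add: tau_walk_def wcomp_def)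
qed (simp_all add: tau_walk_def)

lemma hclass_eq_iff:
  assumes "is_walk E u"
  shows "hclass E u = hclass E v \<longleftrightarrow> homotopic E u v"
proof
  assume "hclass E u = hclass E v"
  moreover have "u \<in> hclass E u" using homotopic.refl[OF assms] by (simp add: hclass_def)
  ultimately show "homotopic E u v" by (auto simp: hclass_def intro: homotopic.sym)
next
  assume "homotopic E u v"
  then show "hclass E u = hclass E v"
    unfolding hclass_def
    using homotopic.sym[of E] homotopic.trans[of E] by (intro Collect_cong) blast
qed

lemma hcomp_hclass:
  assumes E: "frac_brauer_config E" and u: "is_walk E u" and v: "is_walk E v"
    and uv: "source u = target v"
  shows "hcomp E (hclass E u) (hclass E v) = hclass E (wcomp u v)"
proof -
  have "hclass E (wcomp u' v') = hclass E (wcomp u v)"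
    if "homotopic E u u'" "homotopic E v v'" for u' v'
  proof -
    note 1 = homotopic_walks[OF E that(1)] and 2 = homotopic_walks[OF E that(2)]
    have "homotopic E (wcomp u v) (wcomp u' v)"
      by (rule homotopic.h5_right[OF that(1) v]) (use 1 uv in auto)
    moreover have "homotopic E (wcomp u' v) (wcomp u' v')"
      by (rule homotopic.h5_left[OF that(2)]) (use 1 2 uv in auto)
    ultimately have "homotopic E (wcomp u v) (wcomp u' v')" by (rule homotopic.trans)
    moreover have "is_walk E (wcomp u v)" using is_walk_wcomp[OF uv, of E] u v by simp
    ultimately show ?thesis using hclass_eq_iff by blast
  qed
  hence *: "hclass E (wcomp u' v') = hclass E (wcomp u v)"
    if "u' \<in> hclass E u" "v' \<in> hclass E v" for u' v'
    using that by (simp add: hclass_def)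
  have "u \<in> hclass E u" "v \<in> hclass E v"
    using homotopic.refl[OF u] homotopic.refl[OF v] by (simp_all add: hclass_def)
  with * show ?thesis unfolding hcomp_def by blast
qed

lemma step_inverse:
  assumes E: "frac_brauer_config E" and x: "x \<in> elems E" "y \<in> elems E" and "is_step E y \<delta> x"
  shows "\<exists>\<epsilon>. is_step E x \<epsilon> y \<and> homotopic E ([(\<epsilon>, x), (\<delta>, y)], x) ([], x)
    \<and> homotopic E ([(\<delta>, y), (\<epsilon>, x)], y) ([], y)"
proof (cases \<delta>)
  case Gen
  hence yx: "y = act E 1 x" "x = act E (-1) y"
    using assms(4) act_inverse[OF E x(1)] by simp_all
  show ?thesis
    using homotopic.h1_inv_gen[OF x(1)] homotopic.h1_gen_inv[OF x(2)] Gen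
    unfolding yx(1)[symmetric] yx(2)[symmetric]
    by (intro exI[of _ GenInv]) (simp add: yx(2)[symmetric])
next
  case GenInv
  hence yx: "y = act E (-1) x" "x = act E 1 y"
    using assms(4) act_inverse[OF E x(1)] by simp_all
  show ?thesis
    using homotopic.h1_inv_gen[OF x(2)] homotopic.h1_gen_inv[OF x(1)] GenInv
    unfolding yx(1)[symmetric] yx(2)[symmetric]
    by (intro exI[of _ Gen]) (simp add: yx(2)[symmetric])
next
  case Tau
  hence P: "pclass E y = pclass E x" using assms by simp
  have "homotopic E (wcomp (tau_walk x y) (tau_walk y x)) ([], x)"
    using homotopic.trans[OF homotopic.h2[OF x(1) x(2) x(1) P P[symmetric]] homotopic.h1_tau[OF x(1)]] .
  moreover have "homotopic E (wcomp (tau_walk y x) (tau_walk x y)) ([], y)"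
    using homotopic.trans[OF homotopic.h2[OF x(2) x(1) x(2) P[symmetric] P] homotopic.h1_tau[OF x(2)]] .
  ultimately show ?thesis
    unfolding Tau tau_walk_def wcomp_def fst_conv snd_conv append.simps
    using P is_step.simps(3) by metis
qed

lemma walk_inverse:
  assumes E: "frac_brauer_config E" and "is_walk E w"
  shows "\<exists>v. is_walk E v \<and> source v = target w \<and> target v = source w \<and>
    homotopic E (wcomp v w) ([], source w) \<and> homotopic E (wcomp w v) ([], target w)"
proof -
  have "is_walk E (s, x) \<Longrightarrow> \<exists>v. is_walk E v \<and> source v = target (s, x) \<and> target v = x \<and>
    homotopic E (wcomp v (s, x)) ([], x) \<and> homotopic E (wcomp (s, x) v) ([], target (s, x))"
    for s x
  proof (induction s)
    case Nil
    then show ?case by (intro exI[of _ "([], x)"]) (auto simp: wcomp_def intro: homotopic.refl)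
  next
    case (Cons a s)
    obtain \<delta> y where a: "a = (\<delta>, y)" by (cases a)
    let ?z = "target (s, x)"
    from Cons a have w: "is_walk E (s, x)" "y \<in> elems E" "is_step E y \<delta> ?z" by auto
    from Cons.IH[OF w(1)] obtain v where v: "is_walk E v" "source v = ?z" "target v = x"
      "homotopic E (wcomp v (s, x)) ([], x)" "homotopic E (wcomp (s, x) v) ([], ?z)" by auto
    have z: "?z \<in> elems E" using is_walk_ends(2)[OF w(1)] .
    obtain \<epsilon> where e: "is_step E ?z \<epsilon> y" "homotopic E ([(\<epsilon>, ?z), (\<delta>, y)], ?z) ([], ?z)"
      "homotopic E ([(\<delta>, y), (\<epsilon>, ?z)], y) ([], y)"
      using step_inverse[OF E z w(2,3)] by auto
    define i where "i = ([(\<epsilon>, ?z)], y)"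
    define b where "b = ([(\<delta>, y)], ?z)"
    have sx: "(a # s, x) = wcomp b (s, x)" by (simp add: a b_def wcomp_def)
    have i: "is_walk E i" "source i = y" "target i = ?z" using w z e by (auto simp: i_def)
    have b: "is_walk E b" "source b = ?z" "target b = y" using w z by (auto simp: b_def)
    have ib: "homotopic E (wcomp i b) ([], ?z)" "homotopic E (wcomp b i) ([], y)"
      using e by (auto simp: i_def b_def wcomp_def)
    have id1: "wcomp ([], ?z) u = u" for u by (simp add: wcomp_def)
    have id2: "wcomp u ([], ?z) = u" if "source u = ?z" for u
      using that by (simp add: wcomp_def source_def prod_eq_iff)
    have "homotopic E (wcomp (wcomp i b) (s, x)) (wcomp ([], ?z) (s, x))"
      by (rule homotopic.h5_right[OF ib(1) w(1)]) (use i b in auto)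
    hence "homotopic E (wcomp v (wcomp (wcomp i b) (s, x))) (wcomp v (s, x))"
      unfolding id1
      by (rule homotopic.h5_left[OF _ v(1)]) (use i b v in \<open>auto simp: target_wcomp\<close>)
    hence 1: "homotopic E (wcomp (wcomp v i) (a # s, x)) ([], x)"
      unfolding sx using homotopic.trans[OF _ v(4)] by (simp add: wcomp_assoc)
    have "homotopic E (wcomp (wcomp (s, x) v) i) (wcomp ([], ?z) i)"
      by (rule homotopic.h5_right[OF v(5) i(1)]) (use i b v in auto)
    hence "homotopic E (wcomp b (wcomp (wcomp (s, x) v) i)) (wcomp b i)"
      unfolding id1
      by (rule homotopic.h5_left[OF _ b(1)]) (use i b v in \<open>auto simp: target_wcomp\<close>)
    hence 2: "homotopic E (wcomp (a # s, x) (wcomp v i)) ([], y)"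
      unfolding sx using homotopic.trans[OF _ ib(2)] by (simp add: wcomp_assoc)
    show ?case
      by (rule exI[of _ "wcomp v i"])
        (use 1 2 v i in \<open>auto simp: is_walk_wcomp target_wcomp a\<close>)
  qed
  from this[of "fst w" "snd w"] show ?thesis using assms(2) by (simp add: source_def)
qed

lemma is_groupoid_fund_groupoid:
  assumes E: "frac_brauer_config E" and A: "A \<subseteq> elems E"
  shows "is_groupoid (fund_groupoid E A)"
proof -
  have id: "([], x) \<in> walks E x x" if "x \<in> A" for x
    using that A by (auto simp: walks_def)
  have comp: "hcomp E (hclass E u) (hclass E v) = hclass E (wcomp u v) \<and> wcomp u v \<in> walks E x z"
    if "u \<in> walks E y z" "v \<in> walks E x y" for u v x y z
    using that hcomp_hclass[OF E] by (auto simp: walks_def is_walk_wcomp target_wcomp)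
  have disj: "x = x' \<and> y = y'" 
    if "u \<in> walks E x y" "v \<in> walks E x' y'" "hclass E u = hclass E v" for u v x y x' y'
    using that homotopic_walks[OF E] hclass_eq_iff[of E u v] by (auto simp: walks_def)
  have units: "wcomp u ([], x) = u" "wcomp ([], y) u = u" if "u \<in> walks E x y" for u x y
    using that by (auto simp: wcomp_def walks_def source_def)
  have inv: "\<exists>v\<in>walks E y x. hclass E (wcomp v u) = hclass E ([], x) \<and>
      hclass E (wcomp u v) = hclass E ([], y)" if "u \<in> walks E x y" for u x y
  proof -
    have u: "is_walk E u" "source u = x" "target u = y" using that by (auto simp: walks_def)
    obtain v where v: "is_walk E v" "source v = y" "target v = x"
      "homotopic E (wcomp v u) ([], x)" "homotopic E (wcomp u v) ([], y)"
      using walk_inverse[OF E u(1)] u by auto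
    have "is_walk E (wcomp v u)" "is_walk E (wcomp u v)"
      using u v by (simp_all add: is_walk_wcomp)
    hence "hclass E (wcomp v u) = hclass E ([], x)" "hclass E (wcomp u v) = hclass E ([], y)"
      using v(4,5) hclass_eq_iff by blast+
    moreover have "v \<in> walks E y x" using v by (simp add: walks_def)
    ultimately show ?thesis by blast
  qed
  show ?thesis
    unfolding is_groupoid_def fund_groupoid_def groupoid_data.simps
  proof (intro conjI ballI impI)
    fix x y x' y'
    assume "hclass E ` walks E x y \<inter> hclass E ` walks E x' y' \<noteq> {}"
    then show "x = x'" "y = y'" using disj by blast+
  next
    fix x y f assume "f \<in> hclass E ` walks E x y" and xy: "x \<in> A" "y \<in> A"
    then obtain u where u: "u \<in> walks E x y" "f = hclass E u" by auto
    show "hcomp E f (hclass E ([], x)) = f" "hcomp E (hclass E ([], y)) f = f"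
      using comp[OF u(1) id[OF xy(1)]] comp[OF id[OF xy(2)] u(1)] units u by auto
    obtain v where v: "v \<in> walks E y x" "hclass E (wcomp v u) = hclass E ([], x)"
      "hclass E (wcomp u v) = hclass E ([], y)" using inv[OF u(1)] by auto
    show "\<exists>g\<in>hclass E ` walks E y x.
       hcomp E g f = hclass E ([], x) \<and> hcomp E f g = hclass E ([], y)"
      using comp[OF u(1) v(1)] comp[OF v(1) u(1)] v u by auto
  next
    fix x y z g f assume "g \<in> hclass E ` walks E x y" "f \<in> hclass E ` walks E y z"
    then show "hcomp E f g \<in> hclass E ` walks E x z" using comp by blast
  next
    fix w x y z h g f
    assume "h \<in> hclass E ` walks E w x" "g \<in> hclass E ` walks E x y" "f \<in> hclass E ` walks E y z"
    then obtain a b c where "h = hclass E a" "g = hclass E b" "f = hclass E c"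
      and w: "a \<in> walks E w x" "b \<in> walks E x y" "c \<in> walks E y z" by auto
    moreover have "wcomp b a \<in> walks E w y" "wcomp c b \<in> walks E x z" 
      using comp w by blast+
    ultimately show "hcomp E (hcomp E f g) h = hcomp E f (hcomp E g h)"
      using comp by (metis wcomp_assoc)
  qed (use id in auto)
qed

lemma group_fund_group:
  assumes "frac_brauer_config E" "x \<in> elems E"
  shows "group (fund_group E x)"
proof -
  have "is_groupoid (fund_groupoid E {x})"
    using is_groupoid_fund_groupoid assms by blast
  note this[unfolded is_groupoid_def fund_groupoid_def groupoid_data.simps ball_simps(7)]
  note gpd = this[simplified]
  show ?thesis
  proof (rule groupI)
    fix f assume "f \<in> carrier (fund_group E x)"
    then obtain u where u: "u \<in> walks E x x" "f = hclass E u" by (auto simp: fund_group_def)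
    then show "\<exists>g\<in>carrier (fund_group E x). g \<otimes>\<^bsub>fund_group E x\<^esub> f = \<one>\<^bsub>fund_group E x\<^esub>"
      using gpd by (simp add: fund_group_def) blast
  qed (use gpd in \<open>auto simp: fund_group_def\<close>)
qed


section \<open>The associated Brauer graph is a Brauer graph\<close>

lemma act_mult_period:
  assumes A: "group_action integer_group S a" and c: "c \<in> S" "a p c = c"
  shows "a (k * p) c = c"
proof -
  have add: "a (i + j) x = a i (a j x)" if "x \<in> S" for i j x
    using group_action.composition_rule[OF A that, of i j] by simp
  have cl: "a i x \<in> S" if "x \<in> S" for i x
    using group_action.element_image[OF A _ that, of i] by simp
  have z: "a 0 x = x" if "x \<in> S" for x
    using group_action.id_eq_one[OF A] that by simp (metis restrict_apply')
  have m: "a (- p) c = c"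
    using add[OF c(1), of "- p" p] z[OF c(1)] c(2) by simp
  show ?thesis
  proof (induction k rule: int_induct[of _ 0])
    case base show ?case using z[OF c(1)] by simp
  next
    case (step1 i)
    have "(i + 1) * p = i * p + p" by (simp add: algebra_simps)
    then show ?case using step1 add[OF c(1), of "i * p" p] c(2) by simp
  next
    case (step2 i)
    have "(i - 1) * p = i * p + - p" by (simp add: algebra_simps)
    then show ?case using step2 add[OF c(1), of "i * p" "- p"] m by simp
  qed
qed

lemma act_card_orbit:
  assumes A: "group_action integer_group S a" and fin: "finite S" and c: "c \<in> S"
  shows "a (int (card (orbit integer_group a c))) c = c"
proof -
  have add: "a (i + j) x = a i (a j x)" if "x \<in> S" for i j x
    using group_action.composition_rule[OF A that, of i j] by simp
  have cl: "a i x \<in> S" if "x \<in> S" for i x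
    using group_action.element_image[OF A _ that, of i] by simp
  have z: "a 0 x = x" if "x \<in> S" for x
    using group_action.id_eq_one[OF A] that by simp (metis restrict_apply')
  define Q where "Q = orbit integer_group a c"
  have Q: "Q = range (\<lambda>k. a k c)" by (auto simp: Q_def orbit_def)
  have finQ: "finite Q" using finite_subset[of Q S] cl[OF c] fin Q by auto
  have "\<not> inj_on (\<lambda>i. a (int i) c) {..card Q}"
  proof
    assume "inj_on (\<lambda>i. a (int i) c) {..card Q}"
    hence "card ((\<lambda>i. a (int i) c) ` {..card Q}) = Suc (card Q)" by (simp add: card_image)
    moreover have "(\<lambda>i. a (int i) c) ` {..card Q} \<subseteq> Q" unfolding Q by blast
    from card_mono[OF finQ this] have "card ((\<lambda>i. a (int i) c) ` {..card Q}) \<le> card Q" .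
    ultimately show False by linarith
  qed
  then obtain i j where ij: "i < j" "j \<le> card Q" "a (int i) c = a (int j) c"
    unfolding inj_on_def by (metis atMost_iff linorder_neqE_nat)
  define p where "p = j - i"
  have p: "0 < p" "p \<le> card Q" using ij by (auto simp: p_def)
  have "a (- int i + int j) c = a (- int i + int i) c"
    using ij(3) add[OF c] by metis
  hence per: "a (int p) c = c" using z[OF c] ij(1) by (simp add: p_def of_nat_diff)
  have "Q \<subseteq> (\<lambda>i. a (int i) c) ` {..<p}"
  proof
    fix y assume "y \<in> Q"
    then obtain k where k: "y = a k c" using Q by auto
    have "k mod int p + k div int p * int p = k" by simp
    hence "a k c = a (k mod int p) (a (k div int p * int p) c)"
      using add[OF c, of "k mod int p" "k div int p * int p"] by metis
    also have "\<dots> = a (k mod int p) c" using act_mult_period[OF A c per] by metis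
    also have "k mod int p = int (nat (k mod int p))" using p by simp
    finally have "y = a (int (nat (k mod int p))) c" using k by metis
    moreover have "nat (k mod int p) < p" using p by (simp add: nat_less_iff)
    ultimately show "y \<in> (\<lambda>i. a (int i) c) ` {..<p}" by blast
  qed
  hence "card Q \<le> p"
    using surj_card_le[of "{..<p}" Q "\<lambda>i. a (int i) c"] by simp
  hence "p = card Q" using p by simp
  thus ?thesis using per by (simp add: Q_def)
qed

lemma brauer_graphI:
  assumes A: "group_action integer_group (elems C) (act C)"
    and fin: "finite (elems C)"
    and P: "partition_on (elems C) (polys C)"
    and L: "lblocks C = {{c} | c. c \<in> elems C}"
    and card2: "\<And>X. X \<in> polys C \<Longrightarrow> card X = 2"
    and pos: "\<And>c. c \<in> elems C \<Longrightarrow> 0 < deg C c"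
    and deg: "\<And>c c'. c \<in> elems C \<Longrightarrow> c' \<in> gorbit C c \<Longrightarrow> deg C c = deg C c'"
    and dvd: "\<And>c. c \<in> elems C \<Longrightarrow> card (gorbit C c) dvd deg C c"
  shows "brauer_graph C"
proof -
  have LP: "partition_on (elems C) (lblocks C)"
    unfolding L partition_on_def disjoint_def by auto
  have lc: "lclass C c = {c}" if "c \<in> elems C" for c
    unfolding lclass_def by (rule block_eq[OF LP]) (use that L in auto)
  have pc: "c \<in> pclass C c \<and> finite (pclass C c)" if c: "c \<in> elems C" for c
  proof -
    obtain X where X: "X \<in> polys C" "c \<in> X" using P c by (auto simp: partition_on_def)
    hence "pclass C c = X" unfolding pclass_def using block_eq[OF P] by blast
    moreover have "finite X" using card2[OF X(1)] card.infinite by fastforce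
    ultimately show ?thesis using X by simp
  qed
  have ft: "full_turn C c = c" if c: "c \<in> elems C" for c
  proof -
    obtain k where k: "deg C c = card (gorbit C c) * k" using dvd[OF c] by auto
    have "act C (int k * int (card (gorbit C c))) c = c"
      using act_mult_period[OF A c] act_card_orbit[OF A fin c] by (simp add: gorbit_def)
    thus ?thesis by (simp add: full_turn_def k mult.commute)
  qed
  have cl: "act C k c \<in> elems C" if "c \<in> elems C" for k c
    using group_action.element_image[OF A _ that, of k] by simp
  have f6: "\<not> strict_sublist (lseq C e) (lseq C h)" if e: "e \<in> elems C" and h: "h \<in> elems C" for e h
  proof
    assume s: "strict_sublist (lseq C e) (lseq C h)"
    hence sub: "sublist (lseq C e) (lseq C h)" "lseq C e \<noteq> lseq C h"
      by (auto simp: strict_sublist_def)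
    have "lclass C (act C 0 e) \<in> set (lseq C e)"
      using pos[OF e] by (force simp: lseq_def)
    hence "lclass C (act C 0 e) \<in> set (lseq C h)" using set_mono_sublist[OF sub(1)] by blast
    then obtain i where "lclass C (act C 0 e) = lclass C (act C (int i) h)"
      by (auto simp: lseq_def)
    hence "act C 0 e = act C (int i) h" using lc cl e h by (metis singleton_inject)
    moreover have "act C 0 e = e"
      using group_action.id_eq_one[OF A] e by simp (metis restrict_apply')
    ultimately have "e \<in> gorbit C h" by (auto simp: gorbit_def orbit_def)
    hence "deg C h = deg C e" using deg[OF h] by blast
    hence len: "length (lseq C e) = length (lseq C h)" by (simp add: lseq_def)
    obtain ps ss where "lseq C h = ps @ lseq C e @ ss" using sub(1) by (auto simp: sublist_def)
    with len sub(2) show False by simp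
  qed
  have "frac_brauer_config C"
    unfolding frac_brauer_config_def
    using A P LP pos pc lc f6 deg by (intro conjI) (auto simp: ft)
  moreover have "f_degree C c \<in> \<int>" if c: "c \<in> elems C" for c
  proof -
    obtain k where k: "deg C c = card (gorbit C c) * k" using dvd[OF c] by auto
    show ?thesis by (cases "card (gorbit C c) = 0") (auto simp: f_degree_def k)
  qed
  ultimately show ?thesis
    unfolding brauer_graph_def brauer_config_def using fin lc card2 by auto
qed

context
  fixes E :: "'a fbc" and lab :: "'a set \<Rightarrow> nat \<Rightarrow> 'a"
  assumes E: "brauer_config E" and lab: "labelling E lab"
begin

private lemma F: "frac_brauer_config E" and finE: "finite (elems E)"
  and card_ne1: "\<forall>X\<in>polys E. card X \<noteq> 1" and f_int: "\<forall>e\<in>elems E. f_degree E e \<in> \<int>"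
  using E unfolding brauer_config_def by - (elim conjE, assumption)+

private lemma lab_bij: "X \<in> polys E \<Longrightarrow> 3 \<le> card X \<Longrightarrow> bij_betw (lab X) {1..card X} X"
  using lab by (auto simp: labelling_def)

private lemma lab_in: "X \<in> polys E \<Longrightarrow> 3 \<le> card X \<Longrightarrow> i \<in> {1..card X} \<Longrightarrow> lab X i \<in> X"
  using lab_bij bij_betwE by blast

private lemma poly_elems: "X \<in> polys E \<Longrightarrow> x \<in> X \<Longrightarrow> x \<in> elems E"
  using frac_dest(2)[OF F] by (auto simp: partition_on_def)

private lemma poly_unique: "X \<in> polys E \<Longrightarrow> Y \<in> polys E \<Longrightarrow> x \<in> X \<Longrightarrow> x \<in> Y \<Longrightarrow> X = Y"
  using frac_dest(2)[OF F] by (auto simp: partition_on_def disjoint_def)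

private lemma poly_card: "X \<in> polys E \<Longrightarrow> card X = 2 \<or> 3 \<le> card X"
proof -
  assume X: "X \<in> polys E"
  have "X \<noteq> {}" using frac_dest(2)[OF F] X by (auto simp: partition_on_def)
  moreover have "finite X" using finite_subset[of X "elems E"] poly_elems[OF X] finE by blast
  ultimately have "card X \<noteq> 0" by simp
  thus ?thesis using card_ne1 X by force
qed

private lemma lab_eqD:
  assumes "X \<in> polys E" "3 \<le> card X" "Y \<in> polys E" "3 \<le> card Y"
    "i \<in> {1..card X}" "j \<in> {1..card Y}" "lab X i = lab Y j"
  shows "X = Y \<and> i = j"
proof -
  have "X = Y" using poly_unique[OF assms(1,3)] lab_in assms by metis
  moreover have "inj_on (lab X) {1..card X}" using lab_bij assms(1,2) bij_betw_def by blast
  ultimately show ?thesis using assms inj_onD by metis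
qed

private lemma primed_elems: "primed E lab \<subseteq> elems E"
proof
  fix x assume "x \<in> primed E lab"
  then obtain X i where "X \<in> polys E" "3 \<le> card X" "i \<in> {2..card X - 1}" "x = lab X i"
    by (auto simp: primed_def)
  then show "x \<in> elems E" using lab_in[of X i] poly_elems[of X x] by auto
qed

private lemma g_inj: "inj_on (act E 1) (elems E)"
  using group_action.inj_prop[OF frac_dest(1)[OF F]] by simp

private lemma fin_assoc: "finite (assoc_elems E lab)"
  using finE finite_subset[OF primed_elems] by (simp add: assoc_elems_def)

lemma assoc_gen_Bij: "assoc_gen E lab \<in> Bij (assoc_elems E lab)"
proof -
  have "assoc_gen E lab ` assoc_elems E lab \<subseteq> assoc_elems E lab"
    using primed_elems act_closed[OF F] by (auto simp: assoc_gen_def assoc_elems_def)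
  moreover have "inj_on (assoc_gen E lab) (assoc_elems E lab)"
    using primed_elems
    by (intro inj_onI) 
      (auto simp: assoc_gen_def assoc_elems_def split: if_splits dest!: inj_onD[OF g_inj])
  ultimately have "bij_betw (assoc_gen E lab) (assoc_elems E lab) (assoc_elems E lab)"
    using endo_inj_surj[OF fin_assoc] by (auto simp: bij_betw_def)
  thus ?thesis by (simp add: Bij_def assoc_gen_def)
qed

lemma assoc_act_group_action:
  "group_action integer_group (assoc_elems E lab) (assoc_act E lab)"
proof -
  interpret B: group "BijGroup (assoc_elems E lab)" by (rule group_BijGroup)
  have "(\<lambda>k. assoc_act E lab k) \<in> hom integer_group (BijGroup (assoc_elems E lab))"
    unfolding assoc_act_def
    by (rule B.hom_integer_group_pow) (simp add: BijGroup_def assoc_gen_Bij)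
  thus ?thesis
    by (simp add: group_action_def group_hom_def group_hom_axioms_def group_BijGroup)
qed

private lemma assoc_act_1: "assoc_act E lab 1 = assoc_gen E lab"
proof -
  interpret B: group "BijGroup (assoc_elems E lab)" by (rule group_BijGroup)
  show ?thesis unfolding assoc_act_def
    by (rule B.int_pow_1) (simp add: BijGroup_def assoc_gen_Bij)
qed

private abbreviation base :: "'a + 'a \<Rightarrow> 'a" where "base c \<equiv> (case c of Inl h \<Rightarrow> h | Inr h \<Rightarrow> h)"

private lemma base_elems: "c \<in> assoc_elems E lab \<Longrightarrow> base c \<in> elems E"
  using primed_elems by (auto simp: assoc_elems_def)

private lemma orb_sym: "x \<in> elems E \<Longrightarrow> y \<in> gorbit E x \<Longrightarrow> x \<in> gorbit E y"
  and orb_trans: "x \<in> elems E \<Longrightarrow> y \<in> gorbit E x \<Longrightarrow> z \<in> gorbit E y \<Longrightarrow> z \<in> gorbit E x"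
  and orb_refl: "x \<in> elems E \<Longrightarrow> x \<in> gorbit E x"
  and orb_elems: "x \<in> elems E \<Longrightarrow> y \<in> gorbit E x \<Longrightarrow> y \<in> elems E"
proof -
  interpret A: group_action integer_group "elems E" "act E" by (rule frac_dest(1)[OF F])
  have cl: "x \<in> elems E \<Longrightarrow> y \<in> gorbit E x \<Longrightarrow> y \<in> elems E" for x y
    using act_closed[OF F] by (auto simp: gorbit_def orbit_def)
  show "x \<in> elems E \<Longrightarrow> y \<in> gorbit E x \<Longrightarrow> x \<in> gorbit E y"
    using A.orbit_sym cl unfolding gorbit_def by blast
  show "x \<in> elems E \<Longrightarrow> y \<in> gorbit E x \<Longrightarrow> z \<in> gorbit E y \<Longrightarrow> z \<in> gorbit E x"
    using A.orbit_trans cl unfolding gorbit_def by blast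
  show "x \<in> elems E \<Longrightarrow> x \<in> gorbit E x"
    using A.orbit_refl unfolding gorbit_def by blast
  show "x \<in> elems E \<Longrightarrow> y \<in> gorbit E x \<Longrightarrow> y \<in> elems E" by (rule cl)
qed

private lemma base_gen:
  assumes "c \<in> assoc_elems E lab" shows "base (assoc_gen E lab c) \<in> gorbit E (base c)"
proof -
  have "act E 1 x \<in> gorbit E x" for x by (auto simp: gorbit_def orbit_def)
  thus ?thesis using assms orb_refl primed_elems
    by (auto simp: assoc_gen_def assoc_elems_def)
qed

private lemma base_act:
  assumes c: "c \<in> assoc_elems E lab"
  shows "assoc_act E lab k c \<in> assoc_elems E lab \<and> base (assoc_act E lab k c) \<in> gorbit E (base c)"
proof -
  interpret A: group_action integer_group "assoc_elems E lab" "assoc_act E lab"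
    by (rule assoc_act_group_action)
  have cl: "assoc_act E lab i c \<in> assoc_elems E lab" for i
    using A.element_image[of i c] c by simp
  have step: "assoc_act E lab (1 + i) c = assoc_gen E lab (assoc_act E lab i c)" for i
    using A.composition_rule[OF c, of 1 i] by (simp add: assoc_act_1)
  have z: "assoc_act E lab 0 c = c"
    using A.id_eq_one c by simp (metis restrict_apply')
  have "base (assoc_act E lab k c) \<in> gorbit E (base c)"
  proof (induction k rule: int_induct[of _ 0])
    case base show ?case using orb_refl base_elems[OF c] by (simp only: z)
  next
    case (step1 i)
    have "i + 1 = 1 + i" by simp
    then show ?case
      using base_gen[OF cl[of i]] orb_trans[OF base_elems[OF c] step1(2)] by (simp only: step)
  next
    case (step2 i)
    have i: "1 + (i - 1) = i" by simp
    have "base (assoc_act E lab i c) \<in> gorbit E (base (assoc_act E lab (i - 1) c))"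
      using base_gen[OF cl[of "i - 1"]] step[of "i - 1"] unfolding i by simp
    then show ?case
      using orb_sym[OF base_elems[OF cl[of "i - 1"]]] orb_trans[OF base_elems[OF c] step2(2)] by blast
  qed
  thus ?thesis using cl by simp
qed

lemma card_gorbit_dvd_deg: "e \<in> elems E \<Longrightarrow> 0 < card (gorbit E e) \<and> card (gorbit E e) dvd deg E e"
proof -
  assume e: "e \<in> elems E"
  have "finite (gorbit E e)" using finite_subset[of "gorbit E e" "elems E"] orb_elems[OF e] finE by blast
  hence pos: "0 < card (gorbit E e)" using orb_refl[OF e] card_gt_0_iff by blast
  obtain k where "(of_nat (deg E e) / of_nat (card (gorbit E e)) :: rat) = of_int k"
    using f_int e by (auto simp: f_degree_def elim: Ints_cases)
  hence "(of_nat (deg E e) :: rat) = of_int k * of_nat (card (gorbit E e))"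
    using pos by (simp add: field_simps)
  hence "of_int (int (deg E e)) = (of_int (k * int (card (gorbit E e))) :: rat)" by simp
  hence "int (deg E e) = k * int (card (gorbit E e))" by (simp only: of_int_eq_iff)
  hence "int (card (gorbit E e)) dvd int (deg E e)" by simp
  thus ?thesis using pos by simp
qed

lemma of_nat_assoc_deg:
  assumes "h \<in> elems E"
  shows "(of_nat (assoc_deg E lab (Inl h)) :: rat) =
    of_nat (deg E h) * of_nat (card (orbit integer_group (assoc_act E lab) (Inl h))) /
      of_nat (card (gorbit E h))"
proof -
  have "card (gorbit E h) dvd deg E h" using card_gorbit_dvd_deg[OF assms] by blast
  then obtain k where k: "deg E h = card (gorbit E h) * k" by auto
  have "card (gorbit E h) \<noteq> 0" using card_gorbit_dvd_deg[OF assms] by simp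
  then show ?thesis by (simp add: assoc_deg_def k mult.assoc)
qed

private lemma assoc_polys_shape:
  assumes "A \<in> assoc_polys E lab"
  shows "\<exists>X\<in>polys E. (\<forall>c\<in>A. base c \<in> X) \<and>
    (card X = 2 \<and> A = Inl ` X \<or> 3 \<le> card X \<and> (A = {Inl (lab X 1), Inl (lab X 2)} \<or>
      (\<exists>i\<in>{2..card X - 1}. A = {Inr (lab X i), Inl (lab X (i + 1))})))"
  using assms unfolding assoc_polys_def
proof (elim UnE CollectE exE conjE)
  fix X assume "A = Inl ` X" "X \<in> polys E" "card X = 2"
  then show ?thesis by (intro bexI[of _ X]) auto
next
  fix X assume *: "A = {Inl (lab X 1), Inl (lab X 2)}" "X \<in> polys E" "3 \<le> card X"
  then have "\<forall>c\<in>A. base c \<in> X" using lab_in[of X 1] lab_in[of X 2] by simp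
  with * show ?thesis by (intro bexI[of _ X]) simp_all
next
  fix X i assume *: "A = {Inr (lab X i), Inl (lab X (i + 1))}" "X \<in> polys E" "3 \<le> card X"
    "i \<in> {2..card X - 1}"
  then have "\<forall>c\<in>A. base c \<in> X" using lab_in[of X i] lab_in[of X "i + 1"] by auto
  with * show ?thesis by (intro bexI[of _ X]) blast+
qed

private lemma assoc_partition: "partition_on (assoc_elems E lab) (assoc_polys E lab)"
proof (rule partition_onI)
  have sub: "A \<subseteq> assoc_elems E lab" if "A \<in> assoc_polys E lab" for A
    using that unfolding assoc_polys_def
  proof (elim UnE CollectE exE conjE)
    fix X assume "A = Inl ` X" "X \<in> polys E"
    then show ?thesis using poly_elems by (auto simp: assoc_elems_def)
  next
    fix X assume "A = {Inl (lab X 1), Inl (lab X 2)}" "X \<in> polys E" "3 \<le> card X"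
    then show ?thesis using lab_in[of X 1] lab_in[of X 2] poly_elems[of X]
      by (auto simp: assoc_elems_def)
  next
    fix X i assume *: "A = {Inr (lab X i), Inl (lab X (i + 1))}" "X \<in> polys E" "3 \<le> card X"
      "i \<in> {2..card X - 1}"
    hence "lab X i \<in> primed E lab" by (auto simp: primed_def)
    moreover have "lab X (i + 1) \<in> elems E"
      using lab_in[of X "i + 1"] poly_elems[of X] * by auto
    ultimately show ?thesis using * by (auto simp: assoc_elems_def)
  qed
  have cov: "\<exists>A\<in>assoc_polys E lab. c \<in> A" if c: "c \<in> assoc_elems E lab" for c
  proof (cases c)
    case (Inr h)
    hence "h \<in> primed E lab" using c by (auto simp: assoc_elems_def)
    then obtain X i where X: "X \<in> polys E" "3 \<le> card X" "i \<in> {2..card X - 1}" "h = lab X i"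
      by (auto simp: primed_def)
    hence "{Inr (lab X i), Inl (lab X (i + 1))} \<in> assoc_polys E lab"
      by (auto simp: assoc_polys_def)
    then show ?thesis using X Inr by blast
  next
    case (Inl h)
    hence "h \<in> elems E" using c by (auto simp: assoc_elems_def)
    then obtain X where X: "X \<in> polys E" "h \<in> X"
      using frac_dest(2)[OF F] by (auto simp: partition_on_def)
    from poly_card[OF X(1)] show ?thesis
    proof
      assume "card X = 2"
      hence "Inl ` X \<in> assoc_polys E lab" using X by (auto simp: assoc_polys_def)
      then show ?thesis using X Inl by blast
    next
      assume 3: "3 \<le> card X"
      then obtain j where j: "j \<in> {1..card X}" "h = lab X j"
        using bij_betw_imp_surj_on[OF lab_bij[OF X(1) 3]] X(2) by blast
      show ?thesis
      proof (cases "j \<le> 2")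
        case True
        hence "j = 1 \<or> j = 2" using j by auto
        moreover have "{Inl (lab X 1), Inl (lab X 2)} \<in> assoc_polys E lab"
          using X 3 unfolding assoc_polys_def by blast
        ultimately show ?thesis using Inl j by blast
      next
        case False
        hence "j - 1 \<in> {2..card X - 1}" "j - 1 + 1 = j" using j by auto
        moreover have "{Inr (lab X i), Inl (lab X (i + 1))} \<in> assoc_polys E lab"
          if "i \<in> {2..card X - 1}" for i
          using that X(1) 3 unfolding assoc_polys_def by blast
        ultimately have "{Inr (lab X (j - 1)), Inl (lab X j)} \<in> assoc_polys E lab" by metis
        then show ?thesis using Inl j by blast
      qed
    qed
  qed
  show "\<Union> (assoc_polys E lab) = assoc_elems E lab" using sub cov by blast
  show "{} \<notin> assoc_polys E lab"
    using poly_card by (auto simp: assoc_polys_def)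
  have key: "A = B" if A: "A \<in> assoc_polys E lab" and B: "B \<in> assoc_polys E lab"
    and c: "c \<in> A" "c \<in> B" for A B c
  proof -
    obtain X where X: "X \<in> polys E" "\<forall>c\<in>A. base c \<in> X"
      "card X = 2 \<and> A = Inl ` X \<or> 3 \<le> card X \<and> (A = {Inl (lab X 1), Inl (lab X 2)} \<or>
        (\<exists>i\<in>{2..card X - 1}. A = {Inr (lab X i), Inl (lab X (i + 1))}))"
      using assoc_polys_shape[OF A] by blast
    obtain Y where Y: "Y \<in> polys E" "\<forall>c\<in>B. base c \<in> Y"
      "card Y = 2 \<and> B = Inl ` Y \<or> 3 \<le> card Y \<and> (B = {Inl (lab Y 1), Inl (lab Y 2)} \<or>
        (\<exists>i\<in>{2..card Y - 1}. B = {Inr (lab Y i), Inl (lab Y (i + 1))}))"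
      using assoc_polys_shape[OF B] by blast
    have "base c \<in> X" "base c \<in> Y" using X(2) Y(2) c by blast+
    hence [simp]: "Y = X" using poly_unique[OF X(1) Y(1)] by blast
    show ?thesis
    proof (cases "card X = 2")
      case True
      then show ?thesis using X(3) Y(3) by simp
    next
      case False
      hence 3: "3 \<le> card X" using poly_card[OF X(1)] by simp
      have inj: "i = j" if "lab X i = lab X j" "i \<in> {1..card X}" "j \<in> {1..card X}" for i j
        using lab_eqD[OF X(1) 3 X(1) 3] that by blast
      have nx: "lab X (i + 1) \<noteq> lab X 1" "lab X (i + 1) \<noteq> lab X 2" if "i \<in> {2..card X - 1}" for i
      proof -
        have "i + 1 \<in> {1..card X}" "1 \<in> {1..card X}" "2 \<in> {1..card X}" "i + 1 \<noteq> 1" "i + 1 \<noteq> 2"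
          using that 3 by auto
        then show "lab X (i + 1) \<noteq> lab X 1" "lab X (i + 1) \<noteq> lab X 2" using inj by blast+
      qed
      consider "A = {Inl (lab X 1), Inl (lab X 2)}"
        | i where "i \<in> {2..card X - 1}" "A = {Inr (lab X i), Inl (lab X (i + 1))}"
        using X(3) False by blast
      then show ?thesis
      proof cases
        case 1
        consider "B = {Inl (lab X 1), Inl (lab X 2)}"
          | i where "i \<in> {2..card X - 1}" "B = {Inr (lab X i), Inl (lab X (i + 1))}"
          using Y(3) False by auto
        then show ?thesis
        proof cases
          case (2 i)
          then show ?thesis using nx[OF 2(1)] 1 c by auto
        qed (use 1 in simp)
      next
        case (2 i)
        consider "B = {Inl (lab X 1), Inl (lab X 2)}"
          | j where "j \<in> {2..card X - 1}" "B = {Inr (lab X j), Inl (lab X (j + 1))}"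
          using Y(3) False by auto
        then show ?thesis
        proof cases
          case 1
          then show ?thesis using nx[OF 2(1)] 2(2) c by auto
        next
          case B: (2 j)
          have "lab X i = lab X j \<or> lab X (i + 1) = lab X (j + 1)" using B(2) 2(2) c by auto
          moreover have "i \<in> {1..card X}" "j \<in> {1..card X}"
            "i + 1 \<in> {1..card X}" "j + 1 \<in> {1..card X}"
            using 2(1) B(1) 3 by auto
          ultimately have "i = j" using inj[of i j] inj[of "i + 1" "j + 1"] by linarith
          then show ?thesis using B(2) 2(2) by simp
        qed
      qed
    qed
  qed
  show "disjnt p p'" if "p \<in> assoc_polys E lab" "p' \<in> assoc_polys E lab" "p \<noteq> p'" for p p'
    using key that by (auto simp: disjnt_def)
qed

private lemma assoc_polys_card:
  assumes "A \<in> assoc_polys E lab" shows "card A = 2"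
  using assms unfolding assoc_polys_def
proof (elim UnE CollectE exE conjE)
  fix X assume "A = Inl ` X" "card X = 2"
  then show ?thesis by (simp add: card_image)
next
  fix X assume *: "A = {Inl (lab X 1), Inl (lab X 2)}" "X \<in> polys E" "3 \<le> card X"
  then have "lab X 1 \<noteq> lab X 2" using lab_eqD[of X X 1 2] by fastforce
  then show ?thesis using * by simp
qed auto

theorem brauer_graph_assoc_graph: "brauer_graph (assoc_graph E lab)"
proof (rule brauer_graphI)
  let ?C = "assoc_graph E lab"
  interpret A: group_action integer_group "assoc_elems E lab" "assoc_act E lab"
    by (rule assoc_act_group_action)
  have orb: "gorbit ?C c = orbit integer_group (assoc_act E lab) c" for c
    by (simp add: gorbit_def assoc_graph_def)
  have orbD: "c' \<in> assoc_elems E lab \<and> base c' \<in> gorbit E (base c)"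
    if "c \<in> assoc_elems E lab" "c' \<in> gorbit ?C c" for c c'
    using that base_act[OF that(1)] by (auto simp: orb orbit_def)
  have orbC_eq: "gorbit ?C c' = gorbit ?C c"
    if "c \<in> assoc_elems E lab" "c' \<in> gorbit ?C c" for c c'
    using A.orbit_sym A.orbit_trans orbD that unfolding orb
    by (metis (no_types, opaque_lifting) orb orbD subsetI subset_antisym)
  have orbE_eq: "gorbit E y = gorbit E x" if "x \<in> elems E" "y \<in> gorbit E x" for x y
    using orb_sym orb_trans orb_elems that by blast
  have base_orb: "gorbit ?C (Inl (base c)) = gorbit ?C c" if c: "c \<in> assoc_elems E lab" for c
  proof (cases c)
    case (Inr h)
    hence h: "h \<in> primed E lab" using c by (auto simp: assoc_elems_def)
    hence "Inl h \<in> assoc_elems E lab" using primed_elems by (auto simp: assoc_elems_def)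
    moreover from this have "assoc_act E lab 1 (Inl h) = c"
      using h by (simp add: assoc_act_1 assoc_gen_def Inr)
    moreover from this have "c \<in> gorbit ?C (Inl h)"
      unfolding orb orbit_def carrier_integer_group by blast
    ultimately show ?thesis using orbC_eq[of "Inl h" c] Inr by simp
  qed simp
  have degC: "deg ?C c = deg E (base c) div card (gorbit E (base c)) * card (gorbit ?C c)"
    if c: "c \<in> assoc_elems E lab" for c
  proof -
    have "deg ?C c = deg E (base c) * card (gorbit ?C (Inl (base c))) div card (gorbit E (base c))"
      unfolding orb by (simp add: assoc_graph_def assoc_deg_def Let_def)
    thus ?thesis unfolding base_orb[OF c]
      using card_gorbit_dvd_deg[OF base_elems[OF c]] by (simp add: div_mult_swap mult.commute)
  qed
  show "group_action integer_group (elems ?C) (act ?C)"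
    using assoc_act_group_action by (simp add: assoc_graph_def)
  show "finite (elems ?C)" using fin_assoc by (simp add: assoc_graph_def)
  show "partition_on (elems ?C) (polys ?C)" using assoc_partition by (simp add: assoc_graph_def)
  show "lblocks ?C = {{c} | c. c \<in> elems ?C}" by (simp add: assoc_graph_def)
  show "card X = 2" if "X \<in> polys ?C" for X using that assoc_polys_card by (simp add: assoc_graph_def)
  fix c assume "c \<in> elems ?C"
  hence c: "c \<in> assoc_elems E lab" by (simp add: assoc_graph_def)
  show "card (gorbit ?C c) dvd deg ?C c" by (simp add: degC[OF c])
  have "gorbit ?C c \<subseteq> assoc_elems E lab" "c \<in> gorbit ?C c"
    using orbD[OF c] A.orbit_refl[OF c] by (auto simp: orb)
  hence "0 < card (gorbit ?C c)" using fin_assoc finite_subset card_gt_0_iff by blast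
  moreover have "0 < deg E (base c)" using frac_dest(4)[OF F] base_elems[OF c] by blast
  hence "0 < deg E (base c) div card (gorbit E (base c))"
    using card_gorbit_dvd_deg[OF base_elems[OF c]] by (simp add: div_greater_zero_iff dvd_imp_le)
  ultimately show "0 < deg ?C c" by (simp add: degC[OF c])
  fix c' assume c': "c' \<in> gorbit ?C c"
  have "deg E (base c) = deg E (base c')"
    using frac_dest(7)[OF F] base_elems[OF c] orbD[OF c c'] by blast
  moreover have "gorbit E (base c') = gorbit E (base c)"
    using orbE_eq base_elems[OF c] orbD[OF c c'] by blast
  ultimately show "deg ?C c = deg ?C c'"
    using degC[OF c] degC[of c'] orbD[OF c c'] orbC_eq[OF c c'] by simp
qed

end

end

theory Submission
  imports Defs
begin

text \<open>
  Collapsing every new element \<open>e'\<close> onto \<open>e\<close> sends the step \<open>e \<rightarrow> e'\<close> to the identity, the step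
  \<open>e' \<rightarrow> g(e)\<close> to the step \<open>e \<rightarrow> g(e)\<close>, and a step \<open>\<tau>\<close> to a step \<open>\<tau>\<close>; this is a functor
  \<open>\<Pi>(C, C) \<rightarrow> \<Pi>(E, E)\<close>.  Conversely, lift a step of \<open>g\<close> to the one or two steps of \<open>g\<close> above it, and
  \<open>\<tau>\<close> between two elements of a polygon to the path through \<open>e\<^sub>i \<rightarrow> e'\<^sub>i \<rightarrow> e\<^sub>i\<^sub>+\<^sub>1\<close>.  As full turns are
  central loops in a Brauer configuration, relation (h3) amounts to both maps preserving full
  turns, which is what the degree of \<open>C\<close> is made for.  The two functors are mutually inverse on
  \<open>\<Pi>(C, E)\<close>, and on \<open>\<Pi>(C, C)\<close> they are inverse up to the paths \<open>e \<rightarrow> e'\<close>.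
\<close>

section \<open>Calculus of homotopy classes\<close>

text \<open>Both functors are defined on walks, letter by letter, and respect composition on the
  nose; homotopy enters only when relations are checked. Two such maps are compared by naturality
  squares over the letters \<open>g\<close> and \<tau> alone, since squares can be pasted and
  inverted. Origin of the degree of C: f-degrees are integers, so a full turn of E runs m times
  round an orbit, m being the f-degree. Multiplying by the ratio of the orbit sizes makes a full
  turn of C run m times round the larger orbit, hence cover exactly the steps of the turn below.
  Over one polygon, the 2-gons of C and the steps from e_i to e_i' form a path graph from e_1 to
  e_n. Routing every lift of \<tau> through e_1 turns relation (h2) into a cancellation. The
  obstacle: a walk of C between elements of E passes through primed elements, so an induction on
  walks cannot stay inside \<Pi>(C,E). It is carried out on all of C, with correcting paths at the
  ends that are trivial on E.\<close>

declare homotopic.trans [trans]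

text \<open>Only the homotopy class of an inverse matters, so one is chosen instead of reversing
  letters. The price is that images of \<open>winv\<close> cannot be computed; they are reached by
  inverting squares.\<close>

definition winv :: "'a fbc \<Rightarrow> 'a walk \<Rightarrow> 'a walk" where
  "winv E w = (SOME v. is_walk E v \<and> source v = target w \<and> target v = source w \<and>
    homotopic E (wcomp v w) ([], source w) \<and> homotopic E (wcomp w v) ([], target w))"

abbreviation gen_walk :: "'a fbc \<Rightarrow> 'a \<Rightarrow> 'a walk" where
  "gen_walk E x \<equiv> ([(Gen, act E 1 x)], x)"

lemma wcomp_id_left [simp]: "wcomp ([], y) u = u"
  by (simp add: wcomp_def)

lemma wcomp_id_right: "u \<in> walks E x y \<Longrightarrow> wcomp u ([], x) = u"
  by (cases u) (simp add: wcomp_def walks_def)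

lemma walks_id: "x \<in> elems E \<Longrightarrow> ([], x) \<in> walks E x x"
  by (simp add: walks_def)

lemma walks_wcomp: "u \<in> walks E y z \<Longrightarrow> v \<in> walks E x y \<Longrightarrow> wcomp u v \<in> walks E x z"
  by (simp add: walks_def is_walk_wcomp target_wcomp)

lemma walks_ends: "w \<in> walks E x y \<Longrightarrow> x \<in> elems E" "w \<in> walks E x y \<Longrightarrow> y \<in> elems E"
  using is_walk_ends[of E w] by (auto simp: walks_def)

lemma walks_self: "is_walk E w \<Longrightarrow> w \<in> walks E (source w) (target w)"
  by (simp add: walks_def)

lemma walks_step:
  "x \<in> elems E \<Longrightarrow> y \<in> elems E \<Longrightarrow> is_step E y \<delta> x \<Longrightarrow> ([(\<delta>, y)], x) \<in> walks E x y"
  by (simp add: walks_def)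

lemma walks_tau:
  "x \<in> elems E \<Longrightarrow> y \<in> elems E \<Longrightarrow> pclass E y = pclass E x \<Longrightarrow> tau_walk y x \<in> walks E x y"
  by (simp add: walks_def tau_walk_def)

lemma walk_induct [consumes 1, case_names id step]:
  assumes "w \<in> walks E x y"
    and "\<And>x. x \<in> elems E \<Longrightarrow> P x x ([], x)"
    and "\<And>x y z \<delta> w. w \<in> walks E x y \<Longrightarrow> P x y w \<Longrightarrow> z \<in> elems E \<Longrightarrow> is_step E z \<delta> y \<Longrightarrow>
      P x z (wcomp ([(\<delta>, z)], y) w)"
  shows "P x y w"
proof -
  obtain s where w: "w = (s, x)" "is_walk E (s, x)" "y = target (s, x)"
    using assms(1) by (cases w) (auto simp: walks_def)
  have "is_walk E (s, x) \<Longrightarrow> P x (target (s, x)) (s, x)"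
  proof (induction s)
    case Nil
    then show ?case using assms(2) by simp
  next
    case (Cons a s)
    obtain \<delta> z where a: "a = (\<delta>, z)" by (cases a)
    then show ?case
      using Cons assms(3)[of "(s, x)" x "target (s, x)" z \<delta>] by (simp add: walks_def wcomp_def)
  qed
  then show ?thesis using w by simp
qed

locale fbc =
  fixes E :: "'a fbc"
  assumes frac: "frac_brauer_config E"
begin

abbreviation hom (infix "\<approx>" 50) where "u \<approx> v \<equiv> homotopic E u v"

lemmas act_closed = Defs.act_closed[OF frac]

lemma homotopic_walks_iff: "u \<approx> v \<Longrightarrow> u \<in> walks E x y \<longleftrightarrow> v \<in> walks E x y"
  using homotopic_walks[OF frac] by (auto simp: walks_def)

lemma hrefl: "u \<in> walks E x y \<Longrightarrow> u \<approx> u"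
  by (simp add: walks_def homotopic.refl)

lemma hcong:
  assumes "u \<approx> u'" "v \<approx> v'" "u \<in> walks E y z" "v \<in> walks E x y"
  shows "wcomp u v \<approx> wcomp u' v'"
proof -
  have w: "u' \<in> walks E y z" "v' \<in> walks E x y"
    using assms homotopic_walks_iff by blast+
  have "wcomp u v \<approx> wcomp u' v"
    by (rule homotopic.h5_right[OF assms(1)]) (use assms w in \<open>auto simp: walks_def\<close>)
  moreover have "wcomp u' v \<approx> wcomp u' v'"
    by (rule homotopic.h5_left[OF assms(2)]) (use assms w in \<open>auto simp: walks_def\<close>)
  ultimately show ?thesis by (rule homotopic.trans)
qed

lemma hcong_left: "v \<approx> v' \<Longrightarrow> u \<in> walks E y z \<Longrightarrow> v \<in> walks E x y \<Longrightarrow> wcomp u v \<approx> wcomp u v'"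
  using hcong hrefl by blast

lemma hcong_right: "u \<approx> u' \<Longrightarrow> u \<in> walks E y z \<Longrightarrow> v \<in> walks E x y \<Longrightarrow> wcomp u v \<approx> wcomp u' v"
  using hcong hrefl by blast

lemma winv:
  assumes "w \<in> walks E x y"
  shows "winv E w \<in> walks E y x"
    and "wcomp (winv E w) w \<approx> ([], x)" and "wcomp w (winv E w) \<approx> ([], y)"
proof -
  have "\<exists>v. is_walk E v \<and> source v = target w \<and> target v = source w \<and>
    homotopic E (wcomp v w) ([], source w) \<and> homotopic E (wcomp w v) ([], target w)"
    using walk_inverse[OF frac, of w] assms by (simp add: walks_def)
  from someI_ex[OF this, folded winv_def] show "winv E w \<in> walks E y x"
    "wcomp (winv E w) w \<approx> ([], x)" "wcomp w (winv E w) \<approx> ([], y)"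
    using assms by (simp_all add: walks_def)
qed

text \<open>Insert \<open>b' b\<close> in front of \<open>p a'\<close>, replace \<open>b p\<close>
  by \<open>q a\<close>, and cancel \<open>a a'\<close>. Each inverse is thus used on one side
  only.\<close>

lemma inverse_square:
  assumes "wcomp q a \<approx> wcomp b p"
    and w: "a \<in> walks E x y" "b \<in> walks E x' y'" "p \<in> walks E x x'" "q \<in> walks E y y'"
    and w': "a' \<in> walks E y x" "b' \<in> walks E y' x'"
    and inv: "wcomp a a' \<approx> ([], y)" "wcomp b' b \<approx> ([], x')"
  shows "wcomp p a' \<approx> wcomp b' q"
proof -
  have inv': "([], x') \<approx> wcomp b' b" by (rule homotopic.sym[OF inv(2)])
  have "wcomp ([], x') (wcomp p a') \<approx> wcomp (wcomp b' b) (wcomp p a')"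
    by (rule hcong_right[OF inv']) (rule walks_wcomp walks_id walks_ends(1)[OF w(2)] w w')+
  also have "wcomp (wcomp b' b) (wcomp p a') = wcomp b' (wcomp (wcomp b p) a')"
    by (simp add: wcomp_assoc)
  also have "\<dots> \<approx> wcomp b' (wcomp (wcomp q a) a')"
    by (rule hcong_left[OF hcong_right[OF homotopic.sym[OF assms(1)]]]) (rule walks_wcomp w w')+
  also have "\<dots> = wcomp b' (wcomp q (wcomp a a'))"
    by (simp add: wcomp_assoc)
  also have "\<dots> \<approx> wcomp b' (wcomp q ([], y))"
    by (rule hcong_left[OF hcong_left[OF inv(1)]]) (rule walks_wcomp w w')+
  finally show ?thesis using wcomp_id_right[OF w(4)] by simp
qed

end


section \<open>Functors presented on walks, and naturality\<close>

definition walk_hom :: "'a fbc \<Rightarrow> 'b fbc \<Rightarrow> ('a \<Rightarrow> 'b) \<Rightarrow> ('a walk \<Rightarrow> 'b walk) \<Rightarrow> bool" where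
  "walk_hom E F ob A \<longleftrightarrow>
     (\<forall>x y w. w \<in> walks E x y \<longrightarrow> A w \<in> walks F (ob x) (ob y)) \<and>
     (\<forall>x\<in>elems E. A ([], x) = ([], ob x)) \<and>
     (\<forall>x y z u v. u \<in> walks E y z \<longrightarrow> v \<in> walks E x y \<longrightarrow> A (wcomp u v) = wcomp (A u) (A v)) \<and>
     (\<forall>u v. homotopic E u v \<longrightarrow> homotopic F (A u) (A v))"

lemma walk_homD:
  assumes "walk_hom E F ob A"
  shows "w \<in> walks E x y \<Longrightarrow> A w \<in> walks F (ob x) (ob y)"
    and "x \<in> elems E \<Longrightarrow> A ([], x) = ([], ob x)"
    and "u \<in> walks E y z \<Longrightarrow> v \<in> walks E x y \<Longrightarrow> A (wcomp u v) = wcomp (A u) (A v)"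
    and "homotopic E u v \<Longrightarrow> homotopic F (A u) (A v)"
  using assms unfolding walk_hom_def by blast+

lemma walk_hom_id: "walk_hom E E (\<lambda>x. x) (\<lambda>w. w)"
  by (simp add: walk_hom_def)

lemma walk_hom_comp:
  assumes "walk_hom E F ob A" "walk_hom F H ob' B"
  shows "walk_hom E H (\<lambda>x. ob' (ob x)) (\<lambda>w. B (A w))"
  unfolding walk_hom_def
proof (intro conjI allI impI ballI)
  fix x y w assume "w \<in> walks E x y"
  then show "B (A w) \<in> walks H (ob' (ob x)) (ob' (ob y))"
    by (intro walk_homD(1)[OF assms(2)] walk_homD(1)[OF assms(1)])
next
  fix u v assume "homotopic E u v"
  then show "homotopic H (B (A u)) (B (A v))"
    by (intro walk_homD(4)[OF assms(2)] walk_homD(4)[OF assms(1)])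
next
  fix x assume x: "x \<in> elems E"
  then have "ob x \<in> elems F"
    by (intro walks_ends(1)[OF walk_homD(1)[OF assms(1) walks_id]])
  then show "B (A ([], x)) = ([], ob' (ob x))"
    using walk_homD(2)[OF assms(1) x] walk_homD(2)[OF assms(2)] by simp
next
  fix x y z u v assume u: "u \<in> walks E y z" and v: "v \<in> walks E x y"
  show "B (A (wcomp u v)) = wcomp (B (A u)) (B (A v))"
    using walk_homD(3)[OF assms(1) u v]
      walk_homD(3)[OF assms(2) walk_homD(1)[OF assms(1) u] walk_homD(1)[OF assms(1) v]] by simp
qed

text \<open>A square over a walk yields the square over an inverse of it, because both maps preserve
  the cancellations. This spares separate checks for \<open>GenInv\<close> steps and for \<tau>
  steps taken backwards.\<close>

lemma walk_hom_square:
  assumes F: "frac_brauer_config F"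
    and hom: "walk_hom E F ob A" "walk_hom E F ob' B"
    and sq: "homotopic F (wcomp q (A a)) (wcomp (B a) p)"
    and w: "a \<in> walks E x y" "p \<in> walks F (ob x) (ob' x)" "q \<in> walks F (ob y) (ob' y)"
    and inv: "a' \<in> walks E y x" "homotopic E (wcomp a a') ([], y)" "homotopic E (wcomp a' a) ([], x)"
  shows "homotopic F (wcomp p (A a')) (wcomp (B a') q)"
proof -
  interpret F: fbc F by standard (rule F)
  note e = walks_ends[OF w(1)]
  show ?thesis
  proof (rule F.inverse_square[OF sq])
    show "homotopic F (wcomp (A a) (A a')) ([], ob y)"
      using walk_homD(4)[OF hom(1) inv(2)] walk_homD(3)[OF hom(1) w(1) inv(1)]
        walk_homD(2)[OF hom(1) e(2)] by simp
    show "homotopic F (wcomp (B a') (B a)) ([], ob' x)"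
      using walk_homD(4)[OF hom(2) inv(3)] walk_homD(3)[OF hom(2) inv(1) w(1)]
        walk_homD(2)[OF hom(2) e(1)] by simp
  qed (rule w inv walk_homD(1)[OF hom(1)] walk_homD(1)[OF hom(2)])+
qed

lemma (in fbc) walks_gen: "x \<in> elems E \<Longrightarrow> gen_walk E x \<in> walks E x (act E 1 x)"
  by (rule walks_step) (simp_all add: act_closed)

lemma (in fbc) walks_gen_inv: "x \<in> elems E \<Longrightarrow> ([(GenInv, x)], act E 1 x) \<in> walks E (act E 1 x) x"
  by (rule walks_step) (simp_all add: act_closed act_inverse[OF frac])

lemma (in fbc) gen_inv_cancel:
  assumes "x \<in> elems E"
  shows "wcomp (gen_walk E x) ([(GenInv, x)], act E 1 x) \<approx> ([], act E 1 x)"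
    and "wcomp ([(GenInv, x)], act E 1 x) (gen_walk E x) \<approx> ([], x)"
  using homotopic.h1_inv_gen[OF assms] homotopic.h1_gen_inv[OF act_closed[OF assms, of 1]]
  by (simp_all add: wcomp_def act_inverse[OF frac assms])

lemma (in fbc) step_cases:
  assumes "is_step E z \<delta> y" "y \<in> elems E" "z \<in> elems E"
  obtains (gen) "\<delta> = Gen" "z = act E 1 y"
  | (gen_inv) "\<delta> = GenInv" "y = act E 1 z"
  | (tau) "\<delta> = Tau" "pclass E z = pclass E y"
  using assms by (cases \<delta>) (auto simp: act_inverse[OF frac])

text \<open>A natural transformation need only be tested on generators, as squares paste along
  composition. It serves three times: with full turns as components (centrality), with trivial
  components (\<open>down\<close> after \<open>up\<close>), and with the components
  \<open>ascent\<close> (\<open>up\<close> after \<open>down\<close>).\<close>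

lemma walk_hom_natural:
  assumes E: "frac_brauer_config E" and F: "frac_brauer_config F"
    and hom: "walk_hom E F ob A" "walk_hom E F ob' B"
    and \<eta>: "\<And>x. x \<in> elems E \<Longrightarrow> \<eta> x \<in> walks F (ob x) (ob' x)"
    and gen: "\<And>x. x \<in> elems E \<Longrightarrow> homotopic F
      (wcomp (\<eta> (act E 1 x)) (A (gen_walk E x))) (wcomp (B (gen_walk E x)) (\<eta> x))"
    and tau: "\<And>x y. x \<in> elems E \<Longrightarrow> y \<in> elems E \<Longrightarrow> pclass E y = pclass E x \<Longrightarrow>
      homotopic F (wcomp (\<eta> y) (A (tau_walk y x))) (wcomp (B (tau_walk y x)) (\<eta> x))"
    and w: "w \<in> walks E x y"
  shows "homotopic F (wcomp (\<eta> y) (A w)) (wcomp (B w) (\<eta> x))"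
  using w
proof (induction rule: walk_induct)
  case (id x)
  interpret F: fbc F by standard (rule F)
  show ?case
    using walk_homD(2)[OF hom(1) id] walk_homD(2)[OF hom(2) id] wcomp_id_right[OF \<eta>[OF id]]
      F.hrefl[OF \<eta>[OF id]] by simp
next
  case (step x y z \<delta> w)
  interpret E: fbc E by standard (rule E)
  interpret F: fbc F by standard (rule F)
  let ?s = "([(\<delta>, z)], y)"
  note x = walks_ends(1)[OF step.hyps(1)] and y = walks_ends(2)[OF step.hyps(1)]
  have s: "?s \<in> walks E y z" using walks_step y step.hyps by metis
  have sq: "homotopic F (wcomp (\<eta> z) (A ?s)) (wcomp (B ?s) (\<eta> y))"
    using step.hyps(3) y step.hyps(2)
  proof (cases rule: E.step_cases)
    case gen
    then show ?thesis using assms(6)[OF y] by simp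
  next
    case gen_inv
    show ?thesis unfolding gen_inv
      using gen[OF step.hyps(2)]
      by (rule walk_hom_square[OF F hom])
       (use step.hyps E.walks_gen E.walks_gen_inv E.gen_inv_cancel \<eta> E.act_closed in auto)
  next
    case tau
    then show ?thesis using assms(7)[OF y step.hyps(2)] by (simp add: tau_walk_def)
  qed
  note [simp] = walk_homD(3)[OF hom(1) s step.hyps(1)] walk_homD(3)[OF hom(2) s step.hyps(1)]
  note W = walk_homD(1)[OF hom(1) s] walk_homD(1)[OF hom(2) s] \<eta>[OF x] \<eta>[OF y] \<eta>[OF step.hyps(2)]
    walk_homD(1)[OF hom(1) step.hyps(1)] walk_homD(1)[OF hom(2) step.hyps(1)]
  have "homotopic F (wcomp (wcomp (\<eta> z) (A ?s)) (A w)) (wcomp (wcomp (B ?s) (\<eta> y)) (A w))"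
    by (rule F.hcong_right[OF sq]) (rule walks_wcomp W)+
  also have "\<dots> = wcomp (B ?s) (wcomp (\<eta> y) (A w))" by (simp add: wcomp_assoc)
  also have "homotopic F \<dots> (wcomp (B ?s) (wcomp (B w) (\<eta> x)))"
    by (rule F.hcong_left[OF step.IH]) (rule walks_wcomp W)+
  finally show ?case by (simp add: wcomp_assoc)
qed


section \<open>Brauer configurations\<close>

lemma gpow_walk_0: "gpow_walk E 0 x = ([], x)"
  by (simp add: gpow_walk_def)

context fbc
begin

lemma walks_gpow: "x \<in> elems E \<Longrightarrow> gpow_walk E n x \<in> walks E x (act E (int n) x)"
  using gpow_walk_walk[OF frac] by (simp add: walks_def)

lemma act_Suc: "x \<in> elems E \<Longrightarrow> act E (int (Suc n)) x = act E 1 (act E (int n) x)"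
  using act_add[OF frac, of x 1 "int n"] by simp

lemma gpow_walk_Suc:
  assumes "x \<in> elems E"
  shows "gpow_walk E (Suc n) x = wcomp (gen_walk E (act E (int n) x)) (gpow_walk E n x)"
  using act_Suc[OF assms, of n] by (simp add: gpow_walk_def wcomp_def)

lemma gpow_walk_Suc_right:
  assumes "x \<in> elems E"
  shows "gpow_walk E (Suc n) x = wcomp (gpow_walk E n (act E 1 x)) (gen_walk E x)"
proof (induction n)
  case 0
  then show ?case using gpow_walk_Suc[OF assms, of 0] act_zero[OF frac assms]
    by (simp add: gpow_walk_0 wcomp_def)
next
  case (Suc n)
  have "act E (int n) (act E 1 x) = act E (int (Suc n)) x"
    using act_add[OF frac assms, of "int n" 1] by (simp add: add.commute)
  then show ?case
    using gpow_walk_Suc[OF assms, of "Suc n"] gpow_walk_Suc[of "act E 1 x" n] act_closed[OF assms]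
    by (simp add: Suc wcomp_assoc)
qed

end

locale brauer =
  fixes E :: "'a fbc"
  assumes brauer: "brauer_config E"
begin

lemma finite_elems: "finite (elems E)"
  and lclass: "x \<in> elems E \<Longrightarrow> lclass E x = {x}"
  using brauer by (simp_all add: brauer_config_def)

sublocale fbc E
  by standard (use brauer in \<open>simp add: brauer_config_def\<close>)

lemma gorbit_refl: "x \<in> elems E \<Longrightarrow> x \<in> gorbit E x"
  using group_action.orbit_refl[OF frac_dest(1)[OF frac]] by (simp add: gorbit_def)

lemma gorbit_nonempty: "0 < card (gorbit E x)" if "x \<in> elems E"
proof -
  have "gorbit E x \<subseteq> elems E" using act_closed[OF that] by (auto simp: gorbit_def orbit_def)
  then show ?thesis using gorbit_refl[OF that] finite_subset finite_elems card_gt_0_iff by blast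
qed

lemma card_gorbit_dvd_deg:
  assumes x: "x \<in> elems E"
  shows "card (gorbit E x) dvd deg E x"
proof -
  have pos: "0 < card (gorbit E x)" using gorbit_nonempty[OF x] .
  have "f_degree E x \<in> \<int>" using brauer x by (simp add: brauer_config_def)
  then obtain k where "(of_nat (deg E x) / of_nat (card (gorbit E x)) :: rat) = of_int k"
    by (auto simp: f_degree_def elim: Ints_cases)
  then have "(of_nat (deg E x) :: rat) = of_int k * of_nat (card (gorbit E x))"
    using pos by (simp add: field_simps)
  then have "of_int (int (deg E x)) = (of_int (k * int (card (gorbit E x))) :: rat)" by simp
  then have "int (deg E x) = k * int (card (gorbit E x))" by (simp only: of_int_eq_iff)
  then have "int (card (gorbit E x)) dvd int (deg E x)" by simp
  then show ?thesis by simp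
qed

lemma act_card_gorbit: "x \<in> elems E \<Longrightarrow> act E (int (card (gorbit E x))) x = x"
  using act_card_orbit[OF frac_dest(1)[OF frac] finite_elems] by (simp add: gorbit_def)

text \<open>The orbit length is a period, so any exponent may be reduced modulo it. In particular
  negative powers become natural ones, which is what later inductions along an orbit use.\<close>

lemma gorbit_image:
  assumes x: "x \<in> elems E"
  shows "(\<lambda>i. act E (int i) x) ` {..<card (gorbit E x)} = gorbit E x"
proof
  show "(\<lambda>i. act E (int i) x) ` {..<card (gorbit E x)} \<subseteq> gorbit E x"
    by (auto simp: gorbit_def orbit_def)
  show "gorbit E x \<subseteq> (\<lambda>i. act E (int i) x) ` {..<card (gorbit E x)}"
  proof
    fix y assume "y \<in> gorbit E x"
    then obtain k where k: "y = act E k x" by (auto simp: gorbit_def orbit_def)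
    let ?p = "int (card (gorbit E x))"
    have p: "0 < ?p" using gorbit_nonempty[OF x] by simp
    have "act E k x = act E (k mod ?p + k div ?p * ?p) x" by simp
    also have "\<dots> = act E (k mod ?p) (act E (k div ?p * ?p) x)" by (rule act_add[OF frac x])
    also have "act E (k div ?p * ?p) x = x"
      by (rule act_mult_period[OF frac_dest(1)[OF frac] x act_card_gorbit[OF x]])
    finally have "y = act E (int (nat (k mod ?p))) x" using k p by simp
    moreover have "nat (k mod ?p) < card (gorbit E x)" using p by (simp add: nat_less_iff)
    ultimately show "y \<in> (\<lambda>i. act E (int i) x) ` {..<card (gorbit E x)}" by blast
  qed
qed

lemma gorbit_nat: "x \<in> elems E \<Longrightarrow> y \<in> gorbit E x \<Longrightarrow> \<exists>n. y = act E (int n) x"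
  using gorbit_image by blast

text \<open>Integrality of the f-degree makes \<open>deg E x\<close> a multiple of the orbit length,
  a period of \<open>x\<close>. Turns are therefore loops, and (h3) becomes a statement about loops
  commuting with \<tau>.\<close>

lemma full_turn:
  assumes x: "x \<in> elems E"
  shows "full_turn E x = x"
proof -
  obtain k where k: "deg E x = card (gorbit E x) * k" using card_gorbit_dvd_deg[OF x] by blast
  have "act E (int k * int (card (gorbit E x))) x = x"
    by (rule act_mult_period[OF frac_dest(1)[OF frac] x act_card_gorbit[OF x]])
  then show ?thesis by (simp add: full_turn_def k mult.commute)
qed

lemma deg_act:
  assumes x: "x \<in> elems E"
  shows "deg E (act E k x) = deg E x"
proof -
  have "act E k x \<in> gorbit E x" by (auto simp: gorbit_def orbit_def)
  then show ?thesis using frac_dest(7)[OF frac] x by metis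
qed

abbreviation turn_walk :: "'a \<Rightarrow> 'a walk" where
  "turn_walk x \<equiv> gpow_walk E (deg E x) x"

lemma walks_turn: "x \<in> elems E \<Longrightarrow> turn_walk x \<in> walks E x x"
  using walks_gpow[of x "deg E x"] full_turn by (simp add: full_turn_def)

text \<open>Against \<open>g\<close> the two composites are literally the same walk of
  \<open>deg E x + 1\<close> generator steps from \<open>x\<close>, split at either end, since
  degrees are constant on orbits. Against \<tau> the square is (h3) read backwards.\<close>

lemma turn_walk_central:
  assumes "w \<in> walks E x y"
  shows "wcomp (turn_walk y) w \<approx> wcomp w (turn_walk x)"
proof (rule walk_hom_natural[OF frac frac walk_hom_id walk_hom_id _ _ _ assms])
  fix x assume x: "x \<in> elems E"
  show "turn_walk x \<in> walks E x x" by (rule walks_turn[OF x])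
  have "wcomp (turn_walk (act E 1 x)) (gen_walk E x) = wcomp (gen_walk E x) (turn_walk x)"
    using gpow_walk_Suc[OF x, of "deg E x"] gpow_walk_Suc_right[OF x, of "deg E x"] full_turn[OF x]
    by (simp add: deg_act[OF x] full_turn_def)
  moreover have "wcomp (gen_walk E x) (turn_walk x) \<in> walks E x (act E 1 x)"
    by (rule walks_wcomp walks_gen walks_turn x)+
  ultimately show "wcomp (turn_walk (act E 1 x)) (gen_walk E x) \<approx> wcomp (gen_walk E x) (turn_walk x)"
    using hrefl by simp
  fix y assume y: "y \<in> elems E" "pclass E y = pclass E x"
  show "wcomp (turn_walk y) (tau_walk y x) \<approx> wcomp (tau_walk y x) (turn_walk x)"
    using homotopic.sym[OF homotopic.h3[OF x y(1) y(2)[symmetric]]] full_turn x y(1) by simp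
qed

end

text \<open>\<open>G\<close> is indexed by the start of a generator step. A \<open>GenInv\<close>
  step ending at \<open>y\<close> undoes the generator step that starts at \<open>y\<close>, hence
  \<open>winv F (G y)\<close>, whereas the other two letters consult the point
  \<open>target (s, x)\<close> where the step begins.\<close>

fun walk_ext :: "'a fbc \<Rightarrow> 'b fbc \<Rightarrow> ('a \<Rightarrow> 'b) \<Rightarrow> ('a \<Rightarrow> 'b walk) \<Rightarrow> ('a \<Rightarrow> 'a \<Rightarrow> 'b walk) \<Rightarrow>
    'a walk \<Rightarrow> 'b walk" where
  "walk_ext E F ob G T ([], x) = ([], ob x)"
| "walk_ext E F ob G T ((\<delta>, y) # s, x) = wcomp
    (case \<delta> of Gen \<Rightarrow> G (target (s, x)) | GenInv \<Rightarrow> winv F (G y) | Tau \<Rightarrow> T y (target (s, x)))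
    (walk_ext E F ob G T (s, x))"

lemma walk_ext_wcomp:
  assumes "source u = target v"
  shows "walk_ext E F ob G T (wcomp u v) = wcomp (walk_ext E F ob G T u) (walk_ext E F ob G T v)"
proof -
  obtain t x where v: "v = (t, x)" by (cases v)
  have "walk_ext E F ob G T (s @ t, x) =
      wcomp (walk_ext E F ob G T (s, target (t, x))) (walk_ext E F ob G T (t, x))" for s
    by (induction s) (auto simp: wcomp_assoc target_append split: letter.split)
  then show ?thesis using assms v by (cases u) (simp add: wcomp_def)
qed

lemma source_walk_ext: "source (walk_ext E F ob G T w) = ob (source w)"
proof -
  have "source (walk_ext E F ob G T (s, x)) = ob x" for s x
    by (induction s) auto
  then show ?thesis by (cases w) simp
qed

text \<open>By centrality of full turns, relation (h3) of \<open>E\<close> only asks that full turns be sent to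
  full turns.\<close>

lemma walk_hom_ext:
  assumes E: "brauer_config E" and F: "brauer_config F"
    and ob: "\<And>x. x \<in> elems E \<Longrightarrow> ob x \<in> elems F"
    and G: "\<And>x. x \<in> elems E \<Longrightarrow> G x \<in> walks F (ob x) (ob (act E 1 x))"
    and T: "\<And>x y. x \<in> elems E \<Longrightarrow> y \<in> elems E \<Longrightarrow> pclass E y = pclass E x \<Longrightarrow>
      T y x \<in> walks F (ob x) (ob y)"
    and T_id: "\<And>x. x \<in> elems E \<Longrightarrow> homotopic F (T x x) ([], ob x)"
    and T_comp: "\<And>x y z. x \<in> elems E \<Longrightarrow> y \<in> elems E \<Longrightarrow> z \<in> elems E \<Longrightarrow>
      pclass E y = pclass E x \<Longrightarrow> pclass E z = pclass E y \<Longrightarrow>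
      homotopic F (wcomp (T z y) (T y x)) (T z x)"
    and turn: "\<And>x. x \<in> elems E \<Longrightarrow> homotopic F
      (walk_ext E F ob G T (gpow_walk E (deg E x) x)) (gpow_walk F (deg F (ob x)) (ob x))"
  shows "walk_hom E F ob (walk_ext E F ob G T)"
proof -
  interpret E: brauer E by standard (rule E)
  interpret F: brauer F by standard (rule F)
  let ?A = "walk_ext E F ob G T"
  have one [simp]: "?A ([(\<delta>, y)], x) =
    (case \<delta> of Gen \<Rightarrow> G x | GenInv \<Rightarrow> winv F (G y) | Tau \<Rightarrow> T y x)"
    if "x \<in> elems E" "y \<in> elems E" "is_step E y \<delta> x" for x y \<delta>
    using that(3,1,2)
  proof (cases rule: E.step_cases)
    case gen
    then show ?thesis using wcomp_id_right[OF G[OF that(1)]] by simp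
  next
    case gen_inv
    then show ?thesis using wcomp_id_right[OF F.winv(1)[OF G[OF that(2)]]] by simp
  next
    case tau
    then show ?thesis using wcomp_id_right[OF T[OF that(1,2)]] by simp
  qed
  have A: "?A w \<in> walks F (ob x) (ob y)" if "w \<in> walks E x y" for w x y
    using that
  proof (induction rule: walk_induct)
    case (id x)
    then show ?case using ob by (simp add: walks_id)
  next
    case (step x y z \<delta> w)
    note y = walks_ends(2)[OF step.hyps(1)]
    have "?A ([(\<delta>, z)], y) \<in> walks F (ob y) (ob z)"
      using step.hyps(3) y step.hyps(2)
    proof (cases rule: E.step_cases)
      case gen
      then show ?thesis using one[OF y step.hyps(2,3)] G[OF y] by simp
    next
      case gen_inv
      then show ?thesis using one[OF y step.hyps(2,3)] F.winv(1)[OF G[OF step.hyps(2)]] by simp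
    next
      case tau
      then show ?thesis using one[OF y step.hyps(2,3)] T[OF y step.hyps(2)] by simp
    qed
    moreover have "?A (wcomp ([(\<delta>, z)], y) w) = wcomp (?A ([(\<delta>, z)], y)) (?A w)"
      by (rule walk_ext_wcomp) (use step.hyps in \<open>auto simp: walks_def\<close>)
    ultimately show ?case using walks_wcomp step.IH by metis
  qed
  have comp: "?A (wcomp u v) = wcomp (?A u) (?A v)" if "u \<in> walks E y z" "v \<in> walks E x y" for u v x y z
    by (rule walk_ext_wcomp) (use that in \<open>auto simp: walks_def\<close>)
  have tau [simp]: "?A (tau_walk y x) = T y x" if "x \<in> elems E" "y \<in> elems E" "pclass E y = pclass E x" for x y
    using one[of x y Tau] that by (simp add: tau_walk_def)
  have gen: "?A (gen_walk E x) = G x" if "x \<in> elems E" for x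
    using one[of x "act E 1 x" Gen] that E.act_closed by simp
  have gen_inv: "?A ([(GenInv, x)], act E 1 x) = winv F (G x)" if "x \<in> elems E" for x
    using one[of "act E 1 x" x GenInv] that E.act_closed act_inverse[OF E.frac] by simp
  have hom: "homotopic F (?A u) (?A v)" if "homotopic E u v" for u v
    using that
  proof (induction rule: homotopic.induct)
    case (refl w)
    then show ?case using A[OF walks_self] F.hrefl by blast
  next
    case (h1_inv_gen e)
    have "([(GenInv, e), (Gen, act E 1 e)], e) = wcomp ([(GenInv, e)], act E 1 e) (gen_walk E e)"
      by (simp add: wcomp_def)
    then have "?A ([(GenInv, e), (Gen, act E 1 e)], e) = wcomp (winv F (G e)) (G e)"
      using comp[OF E.walks_gen_inv E.walks_gen] gen gen_inv h1_inv_gen by metis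
    then show ?case using F.winv(2)[OF G[OF h1_inv_gen]] by simp
  next
    case (h1_gen_inv e)
    \<comment> \<open>The walk goes from \<open>e\<close> back to \<open>x\<close> and returns. Seen
      from \<open>x\<close> it is a generator step composed with its own inverse, so
      \<open>G\<close> is needed at \<open>x\<close> and not at \<open>e\<close>.\<close>
    define x where "x = act E (-1) e"
    have x: "x \<in> elems E" "e = act E 1 x"
      using h1_gen_inv E.act_closed act_inverse[OF E.frac] by (auto simp: x_def)
    have "([(Gen, e), (GenInv, act E (-1) e)], e) = wcomp (gen_walk E x) ([(GenInv, x)], act E 1 x)"
      unfolding x_def[symmetric] by (simp add: wcomp_def x(2))
    then have "?A ([(Gen, e), (GenInv, act E (-1) e)], e) = wcomp (G x) (winv F (G x))"
      using comp[OF E.walks_gen E.walks_gen_inv] gen gen_inv x(1) by metis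
    then show ?case using F.winv(3)[OF G[OF x(1)]] x(2) by simp
  next
    case (h1_tau e)
    then show ?case using T_id by simp
  next
    case (h2 e0 e1 e2)
    then have "?A (wcomp (tau_walk e2 e1) (tau_walk e1 e0)) = wcomp (T e2 e1) (T e1 e0)"
      using comp[OF walks_tau[of e1 E e2] walks_tau[of e0 E e1]] by simp
    then show ?case using T_comp h2 by simp
  next
    case (h3 e h)
    note W = walks_tau E.walks_turn
    have "?A (wcomp (tau_walk (full_turn E h) (full_turn E e)) (gpow_walk E (deg E e) e)) =
        wcomp (T h e) (?A (E.turn_walk e))"
      using comp[OF W] h3 by (simp add: E.full_turn)
    also have "homotopic F \<dots> (wcomp (T h e) (F.turn_walk (ob e)))"
      by (rule F.hcong_left[OF turn T A[OF E.walks_turn]]) (use h3 in auto)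
    also have "homotopic F \<dots> (wcomp (F.turn_walk (ob h)) (T h e))"
      by (rule homotopic.sym[OF F.turn_walk_central]) (use T h3 in auto)
    also have "homotopic F \<dots> (wcomp (?A (E.turn_walk h)) (T h e))"
      by (rule F.hcong_right[OF homotopic.sym[OF turn] F.walks_turn[OF ob] T]) (use h3 in auto)
    also have "\<dots> = ?A (wcomp (gpow_walk E (deg E h) h) (tau_walk h e))"
      using comp[OF E.walks_turn walks_tau] h3 by simp
    finally show ?case .
  next
    case (h4 e h)
    \<comment> \<open>L-classes are singletons here, so (h4) only compares trivial \<tau> steps
      after and before one generator step.\<close>
    then have [simp]: "h = e" using E.lclass by auto
    have w: "G e \<in> walks F (ob e) (ob (act E 1 e))" using G h4 by blast
    have g: "act E 1 e \<in> elems E" using E.act_closed h4 by blast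
    have pow: "gpow_walk E 1 e = gen_walk E e" by (simp add: gpow_walk_def)
    have "?A (wcomp (tau_walk (act E 1 h) (act E 1 e)) (gpow_walk E 1 e)) =
        wcomp (T (act E 1 e) (act E 1 e)) (G e)"
      using comp[OF walks_tau[OF g g] E.walks_gen[OF h4(1)]] h4 g gen pow by simp
    also have "homotopic F \<dots> (wcomp ([], ob (act E 1 e)) (G e))"
      by (rule F.hcong_right[OF T_id[OF g] T[OF g g] w]) simp
    also have "wcomp ([], ob (act E 1 e)) (G e) = wcomp (G e) ([], ob e)"
      using wcomp_id_right[OF w] by simp
    also have "homotopic F \<dots> (wcomp (G e) (T e e))"
      by (rule F.hcong_left[OF homotopic.sym[OF T_id] w walks_id]) (use h4 ob in auto)
    also have "\<dots> = ?A (wcomp (gpow_walk E 1 h) (tau_walk h e))"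
      using comp[OF E.walks_gen[OF h4(1)] walks_tau[OF h4(1,1)]] h4 gen pow by simp
    finally show ?case .
  next
    case (h5_left u v w)
    note uv = homotopic_walks[OF E.frac h5_left.hyps(1)]
    have "?A (wcomp w u) = wcomp (?A w) (?A u)" "?A (wcomp w v) = wcomp (?A w) (?A v)"
      using h5_left by (simp_all add: walk_ext_wcomp)
    moreover have "?A w \<in> walks F (ob (target u)) (ob (target w))"
      using A[OF walks_self[of E w]] h5_left by simp
    moreover have "?A u \<in> walks F (ob (source u)) (ob (target u))"
      using A[OF walks_self] uv by blast
    ultimately show ?case using F.hcong_left[OF h5_left.IH] by metis
  next
    case (h5_right u v w)
    note uv = homotopic_walks[OF E.frac h5_right.hyps(1)]
    have "?A (wcomp u w) = wcomp (?A u) (?A w)" "?A (wcomp v w) = wcomp (?A v) (?A w)"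
      using h5_right by (simp_all add: walk_ext_wcomp)
    moreover have "?A w \<in> walks F (ob (source w)) (ob (target w))"
      using A[OF walks_self] h5_right by blast
    moreover have "?A u \<in> walks F (ob (target w)) (ob (target u))"
      using A[OF walks_self[of E u]] uv h5_right by simp
    ultimately show ?case using F.hcong_right[OF h5_right.IH] by metis
  qed (blast intro: homotopic.sym homotopic.trans)+
  show ?thesis unfolding walk_hom_def using A comp hom by simp
qed


section \<open>The associated Brauer graph\<close>

text \<open>2-gons enter the construction as whole sets, without labels. A labelling may therefore
  be completed on them without changing C.\<close>

lemma assoc_graph_cong:
  assumes "\<And>X. X \<in> polys E \<Longrightarrow> 3 \<le> card X \<Longrightarrow> lab X = lab' X"
  shows "assoc_graph E lab = assoc_graph E lab'"
proof -
  have pr: "primed E lab = primed E lab'"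
    unfolding primed_def using assms by (intro SUP_cong) auto
  then have el: "assoc_elems E lab = assoc_elems E lab'" by (simp add: assoc_elems_def)
  have "assoc_gen E lab = assoc_gen E lab'" unfolding assoc_gen_def pr el by simp
  then have act: "assoc_act E lab = assoc_act E lab'" unfolding assoc_act_def el by simp
  have "{{Inl (lab X 1), Inl (lab X 2)} | X. X \<in> polys E \<and> 3 \<le> card X} =
      {{Inl (lab' X 1), Inl (lab' X 2) :: 'a + 'a} | X. X \<in> polys E \<and> 3 \<le> card X}"
    by (intro Collect_cong ex_cong1) (auto simp: assms)
  moreover have "{{Inr (lab X i), Inl (lab X (i + 1))} | X i.
        X \<in> polys E \<and> 3 \<le> card X \<and> i \<in> {2..card X - 1}} =
      {{Inr (lab' X i), Inl (lab' X (i + 1)) :: 'a + 'a} | X i.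
        X \<in> polys E \<and> 3 \<le> card X \<and> i \<in> {2..card X - 1}}"
    by (intro Collect_cong ex_cong1) (auto simp: assms)
  ultimately have "assoc_polys E lab = assoc_polys E lab'" by (simp only: assoc_polys_def)
  moreover have "assoc_deg E lab = assoc_deg E lab'" by (simp add: assoc_deg_def act fun_eq_iff)
  ultimately show ?thesis unfolding assoc_graph_def el act by simp
qed

text \<open>Labelling the \<open>2\<close>-gons as well makes them ordinary instances of the construction: every
  polygon of \<open>C\<close> then joins the last element over some \<open>e\<^sub>i\<close> to \<open>e\<^sub>i\<^sub>+\<^sub>1\<close>.\<close>

locale labelled_brauer = brauer +
  fixes lab :: "'a set \<Rightarrow> nat \<Rightarrow> 'a"
  assumes lab_bij: "X \<in> polys E \<Longrightarrow> bij_betw (lab X) {1..card X} X"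
begin

lemma labelling: "labelling E lab"
  using lab_bij by (simp add: labelling_def)

abbreviation C :: "('a + 'a) fbc" where
  "C \<equiv> assoc_graph E lab"

sublocale C: brauer C
  by standard (use brauer_graph_assoc_graph[OF brauer labelling] in \<open>simp add: brauer_graph_def\<close>)

text \<open>Over \<open>x\<close> lie \<open>Inl x\<close> and, if \<open>x\<close> is primed, also
  \<open>Inr x\<close>, reached from it by one step. \<open>top x\<close> is the element from which
  the action moves on to the next element of E.\<close>

definition top :: "'a \<Rightarrow> 'a + 'a" where
  "top x = (if x \<in> primed E lab then Inr x else Inl x)"

definition base :: "'a + 'a \<Rightarrow> 'a" where
  "base c = (case c of Inl x \<Rightarrow> x | Inr x \<Rightarrow> x)"

lemma base_simps [simp]: "base (Inl x) = x" "base (Inr x) = x" "base (top x) = x"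
  by (simp_all add: base_def top_def)

lemma lab_in: "X \<in> polys E \<Longrightarrow> 1 \<le> i \<Longrightarrow> i \<le> card X \<Longrightarrow> lab X i \<in> X"
  using bij_betwE[OF lab_bij[of X]] by simp

lemma poly_elems: "X \<in> polys E \<Longrightarrow> x \<in> X \<Longrightarrow> x \<in> elems E"
  using frac_dest(2)[OF frac] by (auto simp: partition_on_def)

lemma lab_elems: "X \<in> polys E \<Longrightarrow> 1 \<le> i \<Longrightarrow> i \<le> card X \<Longrightarrow> lab X i \<in> elems E"
  using lab_in poly_elems by blast

lemma pclass_poly: "X \<in> polys E \<Longrightarrow> x \<in> X \<Longrightarrow> pclass E x = X"
  using block_eq[OF frac_dest(2)[OF frac]] by (simp add: pclass_def)

lemma pclass_lab: "X \<in> polys E \<Longrightarrow> 1 \<le> i \<Longrightarrow> i \<le> card X \<Longrightarrow> pclass E (lab X i) = X"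
  using lab_in pclass_poly by blast

lemma lab_inj:
  assumes "X \<in> polys E" "1 \<le> i" "i \<le> card X" "1 \<le> j" "j \<le> card X" "lab X i = lab X j"
  shows "i = j"
  using inj_onD[OF bij_betw_imp_inj_on[OF lab_bij[OF assms(1)]] assms(6)] assms(2-5) by simp

lemma card_poly:
  assumes "X \<in> polys E"
  shows "2 \<le> card X"
proof -
  have "finite X" by (rule finite_subset[OF subsetI finite_elems]) (rule poly_elems[OF assms])
  moreover have "X \<noteq> {}" using frac_dest(2)[OF frac] assms by (auto simp: partition_on_def)
  moreover have "card X \<noteq> 1" using brauer assms by (simp add: brauer_config_def)
  ultimately show ?thesis using card_gt_0_iff[of X] by linarith
qed

lemma elems_lab:
  assumes "x \<in> elems E"
  obtains X n where "X \<in> polys E" "n < card X" "x = lab X (Suc n)" "pclass E x = X"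
proof -
  obtain X where X: "X \<in> polys E" "x \<in> X"
    using frac_dest(2)[OF frac] assms by (auto simp: partition_on_def)
  then obtain i where "i \<in> {1..card X}" "x = lab X i"
    using bij_betw_imp_surj_on[OF lab_bij] by blast
  moreover from this have "i - 1 < card X" "Suc (i - 1) = i" by auto
  ultimately show ?thesis using that[of X "i - 1"] X pclass_poly by simp
qed

lemma pclass_in_polys: "x \<in> elems E \<Longrightarrow> pclass E x \<in> polys E"
  by (erule elems_lab) simp

text \<open>A primed element determines its polygon and its index, so only the interior labels of a
  chain carry a prime. A 2-gon has no interior index and needs no separate case.\<close>

lemma primed_lab:
  assumes "X \<in> polys E" "1 \<le> i" "i \<le> card X"
  shows "lab X i \<in> primed E lab \<longleftrightarrow> 2 \<le> i \<and> i < card X"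
proof
  assume "lab X i \<in> primed E lab"
  then obtain Y j where Y: "Y \<in> polys E" "3 \<le> card Y" "2 \<le> j" "j \<le> card Y - 1" "lab X i = lab Y j"
    unfolding primed_def by auto
  moreover from this have "Y = X" using pclass_lab[of Y j] pclass_lab[OF assms] by simp
  ultimately have "i = j" using lab_inj[OF assms, of j] by simp
  then show "2 \<le> i \<and> i < card X" using Y \<open>Y = X\<close> by auto
next
  assume "2 \<le> i \<and> i < card X"
  then have "3 \<le> card X" "i \<in> {2..card X - 1}" by auto
  then show "lab X i \<in> primed E lab" using assms(1) unfolding primed_def by blast
qed

lemma primed_elems: "x \<in> primed E lab \<Longrightarrow> x \<in> elems E"
  unfolding primed_def by (auto intro!: lab_elems)

lemma elems_C: "elems C = Inl ` elems E \<union> Inr ` primed E lab"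
  by (simp add: assoc_graph_def assoc_elems_def)

lemma Inl_elems: "x \<in> elems E \<Longrightarrow> Inl x \<in> elems C"
  by (simp add: elems_C)

lemma top_elems: "x \<in> elems E \<Longrightarrow> top x \<in> elems C"
  by (simp add: elems_C top_def)

lemma base_elems: "c \<in> elems C \<Longrightarrow> base c \<in> elems E"
  using primed_elems by (auto simp: elems_C)

lemma act_C_1: "act C 1 = assoc_gen E lab"
proof -
  interpret B: group "BijGroup (assoc_elems E lab)" by (rule group_BijGroup)
  show ?thesis unfolding assoc_graph_def fbc.simps assoc_act_def
    by (rule B.int_pow_1) (simp add: BijGroup_def assoc_gen_Bij[OF brauer labelling])
qed

lemma act_C_primed: "x \<in> primed E lab \<Longrightarrow> act C 1 (Inl x) = Inr x"
  using primed_elems by (simp add: act_C_1 assoc_gen_def assoc_elems_def)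

lemma act_C_top: "x \<in> elems E \<Longrightarrow> act C 1 (top x) = Inl (act E 1 x)"
  by (simp add: act_C_1 assoc_gen_def assoc_elems_def top_def)

lemma elems_C_cases:
  assumes "c \<in> elems C"
  obtains (primed) x where "x \<in> primed E lab" "c = Inl x" | (top) x where "x \<in> elems E" "c = top x"
proof (cases c)
  case (Inl x)
  then show ?thesis using assms that by (cases "x \<in> primed E lab") (auto simp: elems_C top_def)
next
  case (Inr x)
  then have "x \<in> primed E lab" using assms by (auto simp: elems_C)
  then show ?thesis using that(2)[of x] Inr primed_elems by (simp add: top_def)
qed

text \<open>As e_1 carries no prime, index 1 yields the pair of e_1 and e_2, which for a 2-gon is
  the entire polygon. For each larger index \<open>top\<close> is the new element e_i'.\<close>

lemma polys_C:
  "polys C = {{top (lab X i), Inl (lab X (Suc i))} | X i. X \<in> polys E \<and> 1 \<le> i \<and> i < card X}"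
  (is "_ = ?R")
proof -
  have one: "top (lab X (Suc 0)) = Inl (lab X (Suc 0))" if "X \<in> polys E" for X
    using primed_lab[OF that, of 1] card_poly[OF that] by (simp add: top_def)
  have mid: "top (lab X i) = Inr (lab X i)" if "X \<in> polys E" "2 \<le> i" "i < card X" for X i
    using primed_lab[of X i] that by (simp add: top_def)
  have two: "X = {lab X (Suc 0), lab X (Suc (Suc 0))}" if "X \<in> polys E" "card X = 2" for X
  proof -
    have "{1..2} = {Suc 0, Suc (Suc 0)}" by auto
    then show ?thesis using bij_betw_imp_surj_on[OF lab_bij[OF that(1)]] that(2) by auto
  qed
  show ?thesis
  proof
    show "polys C \<subseteq> ?R"
    proof
      fix A assume "A \<in> polys C"
      then consider X where "A = Inl ` X" "X \<in> polys E" "card X = 2"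
        | X where "A = {Inl (lab X 1), Inl (lab X 2)}" "X \<in> polys E" "3 \<le> card X"
        | X i where "A = {Inr (lab X i), Inl (lab X (i + 1))}" "X \<in> polys E" "3 \<le> card X"
          "i \<in> {2..card X - 1}"
        by (auto simp: assoc_graph_def assoc_polys_def)
      then show "A \<in> ?R"
      proof cases
        case (1 X)
        have "A = {top (lab X (Suc 0)), Inl (lab X (Suc (Suc 0)))}"
          using 1(1) arg_cong[OF two[OF 1(2,3)], of "(`) (Inl :: 'a \<Rightarrow> 'a + 'a)"] one[OF 1(2)] by simp
        moreover have "1 < card X" using 1 by simp
        ultimately show ?thesis using 1(2) by (intro CollectI exI[of _ X] exI[of _ "Suc 0"]) simp
      next
        case (2 X)
        then have "A = {top (lab X (Suc 0)), Inl (lab X (Suc (Suc 0)))}" using one by (simp add: numeral_2_eq_2)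
        moreover have "1 < card X" using 2 by simp
        ultimately show ?thesis using 2(2) by (intro CollectI exI[of _ X] exI[of _ "Suc 0"]) simp
      next
        case (3 X i)
        then have i: "2 \<le> i" "i < card X" by auto
        then have "A = {top (lab X i), Inl (lab X (Suc i))}" using mid[OF 3(2) i] 3(1) by simp
        moreover have "1 \<le> i" "i < card X" using i by auto
        ultimately show ?thesis using 3(2) by (intro CollectI exI[of _ X] exI[of _ i]) simp
      qed
    qed
    show "?R \<subseteq> polys C"
    proof
      fix A assume "A \<in> ?R"
      then obtain X i where X: "A = {top (lab X i), Inl (lab X (Suc i))}" "X \<in> polys E" "1 \<le> i" "i < card X"
        by blast
      consider "card X = 2" "i = 1" | "3 \<le> card X" "i = 1" | "3 \<le> card X" "2 \<le> i" using X by linarith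
      then have "A \<in> assoc_polys E lab"
      proof cases
        case a: 1
        then have "A = Inl ` X"
          using X(1) arg_cong[OF two[OF X(2)], of "(`) (Inl :: 'a \<Rightarrow> 'a + 'a)"] one[OF X(2)] by simp
        then show ?thesis using X(2) a unfolding assoc_polys_def by (intro UnI1 CollectI exI[of _ X]) simp
      next
        case 2
        then have "A = {Inl (lab X 1), Inl (lab X 2)}" using one[OF X(2)] X(1) by (simp add: numeral_2_eq_2)
        then show ?thesis using X(2) 2 unfolding assoc_polys_def by (intro UnI1 UnI2 CollectI exI[of _ X]) simp
      next
        case 3
        then have "A = {Inr (lab X i), Inl (lab X (i + 1))}" "i \<in> {2..card X - 1}"
          using X mid[OF X(2) 3(2) X(4)] 3(2) by simp_all
        then show ?thesis
          using X(2) 3(1) unfolding assoc_polys_def by (intro UnI2 CollectI exI[of _ X] exI[of _ i]) simp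
      qed
      then show "A \<in> polys C" by (simp add: assoc_graph_def)
    qed
  qed
qed

lemma pclass_C:
  assumes "X \<in> polys E" "1 \<le> i" "i < card X"
  shows "pclass C (Inl (lab X (Suc i))) = pclass C (top (lab X i))"
proof -
  have "{top (lab X i), Inl (lab X (Suc i))} \<in> polys C" using assms polys_C by blast
  then show ?thesis using block_eq[OF frac_dest(2)[OF C.frac]] by (simp add: pclass_def)
qed

text \<open>Polygons of C are pairs, so a nontrivial \<tau> step is a single rung, climbed or
  descended. The comparison of \<open>up\<close> after \<open>down\<close> with the identity thus
  reduces to one rung at a time.\<close>

lemma pclass_C_cases:
  assumes "c \<in> elems C" "c' \<in> elems C" "pclass C c' = pclass C c"
  obtains (eq) "c' = c"
  | (up) X i where "X \<in> polys E" "1 \<le> i" "i < card X" "c = top (lab X i)" "c' = Inl (lab X (Suc i))"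
  | (down) X i where "X \<in> polys E" "1 \<le> i" "i < card X" "c' = top (lab X i)" "c = Inl (lab X (Suc i))"
proof -
  note P = frac_dest(2)[OF C.frac]
  obtain Y where Y: "Y \<in> polys C" "c \<in> Y" using P assms(1) by (auto simp: partition_on_def)
  obtain Y' where Y': "Y' \<in> polys C" "c' \<in> Y'" using P assms(2) by (auto simp: partition_on_def)
  have "Y' = Y" using assms(3) block_eq[OF P Y] block_eq[OF P Y'] by (simp add: pclass_def)
  moreover obtain X i where X: "X \<in> polys E" "1 \<le> i" "i < card X" "Y = {top (lab X i), Inl (lab X (Suc i))}"
    using Y(1) unfolding polys_C by blast
  ultimately have "c' = c \<or> c = top (lab X i) \<and> c' = Inl (lab X (Suc i)) \<or>
      c' = top (lab X i) \<and> c = Inl (lab X (Suc i))" using Y Y' by blast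
  then show ?thesis using that X by blast
qed

lemma pclass_base:
  assumes "c \<in> elems C" "c' \<in> elems C" "pclass C c' = pclass C c"
  shows "pclass E (base c') = pclass E (base c)"
  using assms by (cases rule: pclass_C_cases) (simp_all add: pclass_lab)


lemma base_act_C:
  assumes "c \<in> elems C"
  shows "base (act C 1 c) = (if c \<in> Inl ` primed E lab then base c else act E 1 (base c))"
  using assms
proof (cases rule: elems_C_cases)
  case (primed x)
  then show ?thesis by (simp add: act_C_primed)
next
  case (top x)
  then have "c \<notin> Inl ` primed E lab" by (auto simp: top_def split: if_splits)
  then show ?thesis using top by (simp add: act_C_top)
qed


subsection \<open>Degrees\<close>

text \<open>\<open>steps n x\<close> is the number of steps by \<open>g\<close> in \<open>C\<close> covering \<open>n\<close> steps in \<open>E\<close>.\<close>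

definition steps :: "nat \<Rightarrow> 'a \<Rightarrow> nat" where
  "steps n x = (\<Sum>i<n. if act E (int i) x \<in> primed E lab then 2 else 1)"

lemma steps_Suc: "steps (Suc n) x = (if act E (int n) x \<in> primed E lab then 2 else 1) + steps n x"
  by (simp add: steps_def)

lemma act_C_steps: "x \<in> elems E \<Longrightarrow> act C (int (steps n x)) (Inl x) = Inl (act E (int n) x)"
proof (induction n)
  case 0
  then show ?case using act_zero[OF frac] act_zero[OF C.frac Inl_elems] by (simp add: steps_def)
next
  case (Suc n)
  let ?y = "act E (int n) x"
  note y = act_closed[OF Suc.prems, of "int n"]
  note next_C = C.act_Suc[OF Inl_elems[OF Suc.prems]]
  show ?case
  proof (cases "?y \<in> primed E lab")
    case True
    then have "steps (Suc n) x = Suc (Suc (steps n x))" by (simp add: steps_Suc)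
    moreover have "act C 1 (Inr ?y) = Inl (act E 1 ?y)" using act_C_top[OF y] True by (simp add: top_def)
    ultimately show ?thesis using Suc next_C act_Suc[OF Suc.prems] act_C_primed[OF True]
      by (simp only:)
  next
    case False
    then have "steps (Suc n) x = Suc (steps n x)" by (simp add: steps_Suc)
    moreover have "act C 1 (Inl ?y) = Inl (act E 1 ?y)" using act_C_top[OF y] False by (simp add: top_def)
    ultimately show ?thesis using Suc next_C act_Suc[OF Suc.prems] by (simp only:)
  qed
qed

lemma steps_add:
  "x \<in> elems E \<Longrightarrow> steps (m + n) x = steps n x + steps m (act E (int n) x)"
proof (induction m)
  case 0
  then show ?case by (simp add: steps_def)
next
  case (Suc m)
  then show ?case
    using steps_Suc[of "m + n" x] steps_Suc[of m "act E (int n) x"] act_add[OF frac, of x "int m" "int n"]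
    by simp
qed

lemma steps_period:
  assumes x: "x \<in> elems E"
  shows "steps (k * card (gorbit E x)) x = k * steps (card (gorbit E x)) x"
proof (induction k)
  case 0
  then show ?case by (simp add: steps_def)
next
  case (Suc k)
  then show ?case
    using steps_add[OF x, of "k * card (gorbit E x)" "card (gorbit E x)"] act_card_gorbit[OF x]
    by (simp add: add.commute)
qed

lemma gorbit_C:
  assumes x: "x \<in> elems E"
  shows "gorbit C (Inl x) = Inl ` gorbit E x \<union> Inr ` (gorbit E x \<inter> primed E lab)"
proof
  show "gorbit C (Inl x) \<subseteq> Inl ` gorbit E x \<union> Inr ` (gorbit E x \<inter> primed E lab)"
  proof
    fix c assume "c \<in> gorbit C (Inl x)"
    then obtain n where n: "c = act C (int n) (Inl x)"
      using C.gorbit_nat[OF Inl_elems[OF x]] by blast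
    then have c: "c \<in> elems C" using C.act_closed Inl_elems x by simp
    have "base (act C (int n) (Inl x)) \<in> gorbit E x"
    proof (induction n)
      case 0
      then show ?case using act_zero[OF C.frac Inl_elems[OF x]] gorbit_refl[OF x] by simp
    next
      case (Suc n)
      let ?c = "act C (int n) (Inl x)"
      have c: "?c \<in> elems C" by (rule C.act_closed[OF Inl_elems[OF x]])
      obtain k where k: "base ?c = act E k x" using Suc by (auto simp: gorbit_def orbit_def)
      have "act E 1 (base ?c) = act E (1 + k) x" using act_add[OF frac x, of 1 k] k by simp
      then have "act E 1 (base ?c) \<in> gorbit E x" by (auto simp: gorbit_def orbit_def)
      then show ?case
        using base_act_C[OF c] C.act_Suc[OF Inl_elems[OF x], of n] Suc by (simp only: split: if_split) simp
    qed
    then have "base c \<in> gorbit E x" using n by simp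
    then show "c \<in> Inl ` gorbit E x \<union> Inr ` (gorbit E x \<inter> primed E lab)"
      using c by (cases c) (auto simp: elems_C)
  qed
  have 1: "Inl y \<in> gorbit C (Inl x) \<and> (y \<in> primed E lab \<longrightarrow> Inr y \<in> gorbit C (Inl x))"
    if y: "y \<in> gorbit E x" for y
  proof -
    obtain n where n: "y = act E (int n) x" using gorbit_nat[OF x y] by blast
    have in_orb: "act C k (Inl x) \<in> gorbit C (Inl x)" for k by (auto simp: gorbit_def orbit_def)
    have "Inl y = act C (int (steps n x)) (Inl x)" using act_C_steps[OF x] n by simp
    moreover from this have "Inr y = act C (int (Suc (steps n x))) (Inl x)" if "y \<in> primed E lab"
      using C.act_Suc[OF Inl_elems[OF x], of "steps n x"] act_C_primed[OF that] by simp
    ultimately show ?thesis using in_orb by metis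
  qed
  then show "Inl ` gorbit E x \<union> Inr ` (gorbit E x \<inter> primed E lab) \<subseteq> gorbit C (Inl x)" by auto
qed

text \<open>One round of the orbit in E meets each element once, and each primed element costs one
  extra step in C. The same count gives the size of the orbit in C.\<close>

lemma card_gorbit_C:
  assumes x: "x \<in> elems E"
  shows "card (gorbit C (Inl x)) = steps (card (gorbit E x)) x"
proof -
  let ?O = "gorbit E x"
  have fin: "finite ?O" using gorbit_nonempty[OF x] card_gt_0_iff by blast
  \<comment> \<open>A surjection between finite sets of equal size is injective.\<close>
  have bij: "bij_betw (\<lambda>i. act E (int i) x) {..<card ?O} ?O"
    using gorbit_image[OF x] eq_card_imp_inj_on[of "{..<card ?O}" "\<lambda>i. act E (int i) x"]
    by (simp add: bij_betw_def)
  have "steps (card ?O) x = (\<Sum>y\<in>?O. if y \<in> primed E lab then 2 else 1)"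
    unfolding steps_def by (rule sum.reindex_bij_betw[OF bij])
  also have "\<dots> = (\<Sum>y\<in>?O. 1 + (if y \<in> primed E lab then 1 else 0))" by (intro sum.cong) auto
  also have "\<dots> = card ?O + card (?O \<inter> primed E lab)"
    using sum.inter_restrict[OF fin, of "\<lambda>_. 1::nat" "primed E lab"] unfolding sum.distrib by simp
  also have "\<dots> = card (gorbit C (Inl x))"
    unfolding gorbit_C[OF x] using fin by (subst card_Un_disjoint) (auto simp: card_image)
  finally show ?thesis by simp
qed

text \<open>Write the degree in E as \<open>k\<close> rounds of the orbit. The ratio of orbit sizes
  converts it into \<open>k\<close> rounds of the orbit in C, that is, into the steps lying over the
  full turn of E. Both elements over \<open>x\<close> get the same value.\<close>

lemma deg_C:
  assumes c: "c \<in> elems C"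
  shows "deg C c = steps (deg E (base c)) (base c)"
proof -
  note x = base_elems[OF c]
  let ?p = "card (gorbit E (base c))"
  obtain k where k: "deg E (base c) = ?p * k" using card_gorbit_dvd_deg[OF x] by blast
  have "deg C c = deg E (base c) * card (gorbit C (Inl (base c))) div ?p"
    by (simp add: assoc_graph_def assoc_deg_def base_def gorbit_def Let_def)
  also have "\<dots> = k * steps ?p (base c)"
    using gorbit_nonempty[OF x] by (simp add: card_gorbit_C[OF x] k mult.assoc)
  finally show ?thesis using steps_period[OF x, of k] by (simp add: k mult.commute)
qed

text \<open>Used with \<open>R u' u\<close> being \<open>down u' = u\<close> and \<open>up u = u'\<close>.\<close>

lemma gpow_walk_C_steps:
  assumes x: "x \<in> elems E"
    and single: "\<And>y. y \<in> elems E \<Longrightarrow> y \<notin> primed E lab \<Longrightarrow> R (gen_walk C (Inl y)) (gen_walk E y)"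
    and double: "\<And>y. y \<in> primed E lab \<Longrightarrow> R (wcomp (gen_walk C (Inr y)) (gen_walk C (Inl y))) (gen_walk E y)"
    and nil: "R ([], Inl x) ([], x)"
    and comp: "\<And>y z u v u' v'. u \<in> walks E y z \<Longrightarrow> v \<in> walks E x y \<Longrightarrow>
      u' \<in> walks C (Inl y) (Inl z) \<Longrightarrow> v' \<in> walks C (Inl x) (Inl y) \<Longrightarrow>
      R u' u \<Longrightarrow> R v' v \<Longrightarrow> R (wcomp u' v') (wcomp u v)"
  shows "R (gpow_walk C (steps n x) (Inl x)) (gpow_walk E n x)"
proof (induction n)
  case 0
  then show ?case using nil by (simp add: steps_def gpow_walk_0)
next
  case (Suc n)
  let ?y = "act E (int n) x" and ?m = "steps n x"
  note y = act_closed[OF x, of "int n"]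
  note suc_C = C.gpow_walk_Suc[OF Inl_elems[OF x]] and act_C = act_C_steps[OF x, of n]
  have v': "gpow_walk C ?m (Inl x) \<in> walks C (Inl x) (Inl ?y)"
    using C.walks_gpow[OF Inl_elems[OF x], of ?m] by (simp only: act_C)
  note rest = comp[OF walks_gen[OF y] walks_gpow[OF x] _ v' _ Suc]
  have top: "gen_walk C (top ?y) \<in> walks C (top ?y) (Inl (act E 1 ?y))"
    using C.walks_gen[OF top_elems[OF y]] by (simp add: act_C_top[OF y])
  show ?case
  proof (cases "?y \<in> primed E lab")
    case True
    have "steps (Suc n) x = Suc (Suc ?m)" using True by (simp add: steps_Suc)
    moreover have "act C (int (Suc ?m)) (Inl x) = Inr ?y"
      using C.act_Suc[OF Inl_elems[OF x], of ?m] act_C act_C_primed[OF True] by simp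
    ultimately have "gpow_walk C (steps (Suc n) x) (Inl x) =
        wcomp (wcomp (gen_walk C (Inr ?y)) (gen_walk C (Inl ?y))) (gpow_walk C ?m (Inl x))"
      using suc_C[of "Suc ?m"] suc_C[of ?m] by (simp only: act_C wcomp_assoc)
    moreover have "wcomp (gen_walk C (Inr ?y)) (gen_walk C (Inl ?y)) \<in> walks C (Inl ?y) (Inl (act E 1 ?y))"
      using walks_wcomp[OF _ C.walks_gen[OF Inl_elems[OF y]]] top True
      by (simp add: act_C_primed top_def)
    ultimately show ?thesis using rest double[OF True] gpow_walk_Suc[OF x] by simp
  next
    case False
    then have "steps (Suc n) x = Suc ?m" by (simp add: steps_Suc)
    then have "gpow_walk C (steps (Suc n) x) (Inl x) = wcomp (gen_walk C (Inl ?y)) (gpow_walk C ?m (Inl x))"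
      using suc_C[of ?m] by (simp only: act_C)
    moreover have "gen_walk C (Inl ?y) \<in> walks C (Inl ?y) (Inl (act E 1 ?y))"
      using top False by (simp add: top_def)
    ultimately show ?thesis using rest single[OF y False] gpow_walk_Suc[OF x] by simp
  qed
qed


subsection \<open>The functors between the two groupoids\<close>

definition down :: "('a + 'a) walk \<Rightarrow> 'a walk" where
  "down = walk_ext C E base
     (\<lambda>c. if c \<in> Inl ` primed E lab then ([], base c) else gen_walk E (base c))
     (\<lambda>c' c. tau_walk (base c') (base c))"

lemma down_wcomp: "source u = target v \<Longrightarrow> down (wcomp u v) = wcomp (down u) (down v)"
  unfolding down_def by (rule walk_ext_wcomp)

lemma down_gen: "down (gen_walk C c) =
    (if c \<in> Inl ` primed E lab then ([], base c) else gen_walk E (base c))"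
  by (simp add: down_def wcomp_def)

lemma down_tau: "down (tau_walk c' c) = tau_walk (base c') (base c)"
  by (simp add: down_def tau_walk_def wcomp_def)

lemma Inr_not_primed: "Inr x \<notin> Inl ` primed E lab"
  by auto

text \<open>At an old element the turn of C covers the turn of E step by step. At e' it is the turn
  at e conjugated by the step from e to e', and \<open>down\<close> sends that step to a trivial
  walk.\<close>

lemma down_turn:
  assumes c: "c \<in> elems C"
  shows "down (C.turn_walk c) = turn_walk (base c)"
proof -
  have *: "down (C.turn_walk (Inl x)) = turn_walk x" if x: "x \<in> elems E" for x
    unfolding deg_C[OF Inl_elems[OF x]] base_simps
  proof (rule gpow_walk_C_steps[OF x])
    fix y assume y: "y \<in> primed E lab"
    have "down (wcomp (gen_walk C (Inr y)) (gen_walk C (Inl y))) =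
        wcomp (down (gen_walk C (Inr y))) (down (gen_walk C (Inl y)))"
      by (rule down_wcomp) (simp add: act_C_primed[OF y])
    then show "down (wcomp (gen_walk C (Inr y)) (gen_walk C (Inl y))) = gen_walk E y"
      using y by (simp add: down_gen Inr_not_primed wcomp_def)
  next
    fix y z u v u' v'
    assume "u' \<in> walks C (Inl y) (Inl z)" "v' \<in> walks C (Inl x) (Inl y)" "down u' = u" "down v' = v"
    then show "down (wcomp u' v') = wcomp u v"
      by (simp add: down_wcomp walks_def)
  next
    show "down ([], Inl x) = ([], x)" by (simp add: down_def)
  qed (auto simp: down_gen)
  show ?thesis
  proof (cases c)
    case (Inl x)
    then show ?thesis using *[OF base_elems[OF c]] by simp
  next
    case (Inr x)
    then have p: "x \<in> primed E lab" using c by (auto simp: elems_C)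
    note x = primed_elems[OF p] and Ix = Inl_elems[OF primed_elems[OF p]]
    have deg: "deg C (Inr x) = deg C (Inl x)"
      using deg_C[OF c] deg_C[OF Ix] Inr by simp
    have "wcomp (C.turn_walk (Inr x)) (gen_walk C (Inl x)) = wcomp (gen_walk C (Inl x)) (C.turn_walk (Inl x))"
      using C.gpow_walk_Suc[OF Ix, of "deg C (Inl x)"] C.gpow_walk_Suc_right[OF Ix, of "deg C (Inl x)"]
        C.full_turn[OF Ix]
      by (simp add: deg act_C_primed[OF p] full_turn_def)
    then have "down (wcomp (C.turn_walk (Inr x)) (gen_walk C (Inl x))) =
        down (wcomp (gen_walk C (Inl x)) (C.turn_walk (Inl x)))" by simp
    moreover have "down (wcomp (C.turn_walk (Inr x)) (gen_walk C (Inl x))) =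
        wcomp (down (C.turn_walk (Inr x))) (down (gen_walk C (Inl x)))"
      by (rule down_wcomp) (simp add: act_C_primed[OF p] gpow_walk_def)
    moreover have "down (wcomp (gen_walk C (Inl x)) (C.turn_walk (Inl x))) =
        wcomp (down (gen_walk C (Inl x))) (down (C.turn_walk (Inl x)))"
      by (rule down_wcomp) (use C.walks_turn[OF Ix] in \<open>simp add: walks_def\<close>)
    moreover have "source (down (C.turn_walk (Inr x))) = x"
      unfolding down_def source_walk_ext by (simp add: gpow_walk_def)
    ultimately have "down (C.turn_walk (Inr x)) = turn_walk x"
      using p *[OF x] by (simp add: down_gen wcomp_def source_def prod_eq_iff)
    then show ?thesis using Inr by simp
  qed
qed

lemma walk_hom_down: "walk_hom C E base down"
  unfolding down_def
proof (rule walk_hom_ext[OF C.brauer brauer])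
  fix c assume c: "c \<in> elems C"
  show "base c \<in> elems E" using base_elems[OF c] .
  show "(if c \<in> Inl ` primed E lab then ([], base c) else gen_walk E (base c))
      \<in> walks E (base c) (base (act C 1 c))"
    using walks_gen[OF base_elems[OF c]] walks_id[OF base_elems[OF c]] by (simp add: base_act_C[OF c])
  show "tau_walk (base c) (base c) \<approx> ([], base c)"
    by (rule homotopic.h1_tau[OF base_elems[OF c]])
  show "walk_ext C E base (\<lambda>c. if c \<in> Inl ` primed E lab then ([], base c) else gen_walk E (base c))
      (\<lambda>c' c. tau_walk (base c') (base c)) (C.turn_walk c) \<approx> turn_walk (base c)"
    using down_turn[OF c] hrefl[OF walks_turn[OF base_elems[OF c]]] by (simp add: down_def)
next
  fix c c' assume "c \<in> elems C" "c' \<in> elems C" "pclass C c' = pclass C c"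
  then show "tau_walk (base c') (base c) \<in> walks E (base c) (base c')"
    by (intro walks_tau base_elems pclass_base)
next
  fix c c' c'' assume "c \<in> elems C" "c' \<in> elems C" "c'' \<in> elems C"
    "pclass C c' = pclass C c" "pclass C c'' = pclass C c'"
  then show "wcomp (tau_walk (base c'') (base c')) (tau_walk (base c') (base c)) \<approx>
      tau_walk (base c'') (base c)"
    by (intro homotopic.h2 base_elems pclass_base)
qed

section \<open>Lifting \<tau>: paths inside one polygon\<close>

definition link :: "'a \<Rightarrow> ('a + 'a) walk" where
  "link x = (if x \<in> primed E lab then gen_walk C (Inl x) else ([], Inl x))"

lemma walks_link:
  assumes "x \<in> elems E"
  shows "link x \<in> walks C (Inl x) (top x)"
proof (cases "x \<in> primed E lab")
  case True
  then show ?thesis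
    using C.walks_gen[OF Inl_elems[OF assms]] by (simp add: link_def top_def act_C_primed[OF True])
next
  case False
  then show ?thesis using walks_id[OF Inl_elems[OF assms]] by (simp add: link_def top_def)
qed

lemma down_link: "down (link x) = ([], x)"
  by (simp add: link_def down_gen) (simp add: down_def)

text \<open>\<open>ladder X n\<close> climbs from \<open>e\<^sub>1\<close> to \<open>e\<^sub>n\<^sub>+\<^sub>1\<close> in the polygon \<open>X\<close>.\<close>

fun ladder :: "'a set \<Rightarrow> nat \<Rightarrow> ('a + 'a) walk" where
  "ladder X 0 = ([], Inl (lab X 1))"
| "ladder X (Suc n) = wcomp
    (wcomp (tau_walk (Inl (lab X (Suc (Suc n)))) (top (lab X (Suc n)))) (link (lab X (Suc n))))
    (ladder X n)"

text \<open>\<open>inv_into\<close> recovers the index i of \<open>x\<close>, and e_i is i - 1 rungs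
  above e_1. All spines of a polygon start at the common base point e_1.\<close>

definition spine :: "'a \<Rightarrow> ('a + 'a) walk" where
  "spine x = (let X = pclass E x in ladder X (inv_into {1..card X} (lab X) x - 1))"

lemma spine_lab:
  assumes "X \<in> polys E" "n < card X"
  shows "spine (lab X (Suc n)) = ladder X n"
  using assms inv_into_f_f[OF bij_betw_imp_inj_on[OF lab_bij[OF assms(1)]], of "Suc n"]
  by (simp add: spine_def pclass_lab)

lemma walks_rung:
  assumes "X \<in> polys E" "1 \<le> i" "i < card X"
  shows "tau_walk (Inl (lab X (Suc i))) (top (lab X i)) \<in> walks C (top (lab X i)) (Inl (lab X (Suc i)))"
  using assms by (intro walks_tau top_elems Inl_elems lab_elems pclass_C) auto

lemma walks_ladder:
  assumes X: "X \<in> polys E"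
  shows "n < card X \<Longrightarrow> ladder X n \<in> walks C (Inl (lab X 1)) (Inl (lab X (Suc n)))"
proof (induction n)
  case 0
  then show ?case using lab_elems[OF X, of 1] by (simp add: walks_id Inl_elems)
next
  case (Suc n)
  have i: "1 \<le> Suc n" "Suc n < card X" "Suc n \<le> card X" using Suc.prems by simp_all
  then show ?case
    using walks_wcomp[OF walks_wcomp[OF walks_rung[OF X i(1,2)] walks_link[OF lab_elems[OF X i(1,3)]]]] Suc.IH
    by simp
qed

lemma walks_spine:
  assumes "x \<in> elems E"
  shows "spine x \<in> walks C (Inl (lab (pclass E x) 1)) (Inl x)"
proof -
  obtain X n where "X \<in> polys E" "n < card X" "x = lab X (Suc n)" "pclass E x = X"
    using elems_lab[OF assms] .
  then show ?thesis using spine_lab walks_ladder[of X n] by simp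
qed

text \<open>\<open>down\<close> makes the links trivial and each rung a \<tau> step; (h2) contracts
  the resulting chain. The empty ladder is matched with a trivial \<tau> step by (h1).\<close>

lemma down_spine:
  assumes "x \<in> elems E"
  shows "down (spine x) \<approx> tau_walk x (lab (pclass E x) 1)"
proof -
  obtain X n where X: "X \<in> polys E" and n: "n < card X" and x: "x = lab X (Suc n)" "pclass E x = X"
    using elems_lab[OF assms] .
  have "n < card X \<Longrightarrow> down (ladder X n) \<approx> tau_walk (lab X (Suc n)) (lab X 1)"
  proof (induction n)
    case 0
    have e: "lab X 1 \<in> elems E" using 0 by (intro lab_elems[OF X]) simp_all
    then show ?case using homotopic.sym[OF homotopic.h1_tau[OF e]] by (simp add: down_def)
  next
    case (Suc n)
    have e: "lab X 1 \<in> elems E" "lab X (Suc n) \<in> elems E" "lab X (Suc (Suc n)) \<in> elems E"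
      using Suc by (auto intro!: lab_elems[OF X])
    have p: "pclass E (lab X (Suc n)) = pclass E (lab X 1)"
      "pclass E (lab X (Suc (Suc n))) = pclass E (lab X (Suc n))"
      using Suc.prems pclass_lab[OF X] by simp_all
    let ?t = "tau_walk (lab X (Suc (Suc n))) (lab X (Suc n))"
    have rung: "tau_walk (Inl (lab X (Suc (Suc n)))) (top (lab X (Suc n)))
        \<in> walks C (top (lab X (Suc n))) (Inl (lab X (Suc (Suc n))))"
      by (rule walks_rung[OF X]) (use Suc.prems in auto)
    have ladder: "ladder X n \<in> walks C (Inl (lab X 1)) (Inl (lab X (Suc n)))"
      by (rule walks_ladder[OF X]) (use Suc.prems in simp)
    note link = walks_link[OF e(2)]
    have "down (ladder X (Suc n)) = wcomp ?t (down (ladder X n))"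
      unfolding ladder.simps
      using walk_homD(3)[OF walk_hom_down walks_wcomp[OF rung link] ladder]
        walk_homD(3)[OF walk_hom_down rung link]
      by (simp add: down_tau down_link) (simp add: wcomp_def tau_walk_def)
    also have "\<dots> \<approx> wcomp ?t (tau_walk (lab X (Suc n)) (lab X 1))"
      using Suc.IH Suc.prems e p walk_homD(1)[OF walk_hom_down ladder]
      by (intro hcong_left[OF _ walks_tau]) auto
    also have "\<dots> \<approx> tau_walk (lab X (Suc (Suc n))) (lab X 1)"
      by (rule homotopic.h2[OF e p])
    finally show ?case .
  qed
  then show ?thesis using x spine_lab[OF X n] n by simp
qed

text \<open>A \<tau> step is lifted by descending one spine to e_1 and climbing another. Inner
  spines then cancel in composites, so (h1) and (h2) hold without comparing the positions of the
  elements in the chain.\<close>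

definition up :: "'a walk \<Rightarrow> ('a + 'a) walk" where
  "up = walk_ext E C Inl (\<lambda>x. wcomp (gen_walk C (top x)) (link x))
     (\<lambda>y x. wcomp (spine y) (winv C (spine x)))"

lemma up_wcomp: "source u = target v \<Longrightarrow> up (wcomp u v) = wcomp (up u) (up v)"
  unfolding up_def by (rule walk_ext_wcomp)

lemma walks_gen_link:
  assumes x: "x \<in> elems E"
  shows "wcomp (gen_walk C (top x)) (link x) \<in> walks C (Inl x) (Inl (act E 1 x))"
  using walks_wcomp[OF C.walks_gen[OF top_elems[OF x]] walks_link[OF x]] by (simp add: act_C_top[OF x])

lemma up_gen: "x \<in> elems E \<Longrightarrow> up (gen_walk E x) = wcomp (gen_walk C (top x)) (link x)"
  using wcomp_id_right[OF walks_gen_link] by (simp add: up_def)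

lemma walks_spines:
  assumes "x \<in> elems E" "y \<in> elems E" "pclass E y = pclass E x"
  shows "wcomp (spine y) (winv C (spine x)) \<in> walks C (Inl x) (Inl y)"
  using walks_wcomp[OF walks_spine[OF assms(2)]] C.winv(1)[OF walks_spine[OF assms(1)]] assms(3)
  by simp

lemma up_tau:
  assumes "x \<in> elems E" "y \<in> elems E" "pclass E y = pclass E x"
  shows "up (tau_walk y x) = wcomp (spine y) (winv C (spine x))"
  using wcomp_id_right[OF walks_spines[OF assms]] by (simp add: up_def tau_walk_def)

text \<open>Equality holds on the nose: each generator step is replaced by the one or two steps of C
  that \<open>steps\<close> counts for it.\<close>

lemma up_turn:
  assumes x: "x \<in> elems E"
  shows "up (turn_walk x) = C.turn_walk (Inl x)"
  unfolding deg_C[OF Inl_elems[OF x]] base_simps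
proof (rule gpow_walk_C_steps[OF x])
  fix y assume "y \<in> elems E" "y \<notin> primed E lab"
  then show "up (gen_walk E y) = gen_walk C (Inl y)"
    by (simp add: up_gen) (simp add: link_def top_def wcomp_def)
next
  fix y assume "y \<in> primed E lab"
  then show "up (gen_walk E y) = wcomp (gen_walk C (Inr y)) (gen_walk C (Inl y))"
    by (simp add: up_gen primed_elems) (simp add: link_def top_def)
next
  fix y z u v u' v'
  assume "u \<in> walks E y z" "v \<in> walks E x y" "up u = u'" "up v = v'"
  then show "up (wcomp u v) = wcomp u' v'"
    by (auto simp: up_wcomp walks_def)
qed (simp add: up_def)

lemma walk_hom_up: "walk_hom E C Inl up"
  unfolding up_def
proof (rule walk_hom_ext[OF brauer C.brauer])
  fix x assume x: "x \<in> elems E"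
  show "Inl x \<in> elems C" by (rule Inl_elems[OF x])
  show "wcomp (gen_walk C (top x)) (link x) \<in> walks C (Inl x) (Inl (act E 1 x))"
    by (rule walks_gen_link[OF x])
  show "C.hom (wcomp (spine x) (winv C (spine x))) ([], Inl x)"
    by (rule C.winv(3)[OF walks_spine[OF x]])
  show "C.hom (walk_ext E C Inl (\<lambda>x. wcomp (gen_walk C (top x)) (link x))
      (\<lambda>y x. wcomp (spine y) (winv C (spine x))) (turn_walk x)) (C.turn_walk (Inl x))"
    using up_turn[OF x] C.hrefl[OF C.walks_turn[OF Inl_elems[OF x]]] by (simp add: up_def)
next
  fix x y assume "x \<in> elems E" "y \<in> elems E" "pclass E y = pclass E x"
  then show "wcomp (spine y) (winv C (spine x)) \<in> walks C (Inl x) (Inl y)"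
    by (rule walks_spines)
next
  fix x y z assume e: "x \<in> elems E" "y \<in> elems E" "z \<in> elems E"
    and p: "pclass E y = pclass E x" "pclass E z = pclass E y"
  let ?b = "Inl (lab (pclass E x) 1)"
  note s = walks_spine[OF e(1)] walks_spine[OF e(2), unfolded p] walks_spine[OF e(3), unfolded p]
  note i = C.winv(1)[OF s(1)] C.winv(1)[OF s(2)]
  have "wcomp (wcomp (spine z) (winv C (spine y))) (wcomp (spine y) (winv C (spine x))) =
      wcomp (spine z) (wcomp (wcomp (winv C (spine y)) (spine y)) (winv C (spine x)))"
    by (simp add: wcomp_assoc)
  also have "C.hom \<dots> (wcomp (spine z) (wcomp ([], ?b) (winv C (spine x))))"
    by (rule C.hcong_left[OF C.hcong_right[OF C.winv(2)[OF s(2)]]]) (rule walks_wcomp s i)+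
  finally show "C.hom (wcomp (wcomp (spine z) (winv C (spine y))) (wcomp (spine y) (winv C (spine x))))
      (wcomp (spine z) (winv C (spine x)))" by simp
qed

section \<open>The two composites of \<open>up\<close> and \<open>down\<close>\<close>

lemma down_up:
  assumes w: "w \<in> walks E x y"
  shows "down (up w) \<approx> w"
proof -
  have comp: "walk_hom E E (\<lambda>x. x) (\<lambda>w. down (up w))"
    using walk_hom_comp[OF walk_hom_up walk_hom_down] by simp
  have "wcomp ([], y) (down (up w)) \<approx> wcomp w ([], x)"
  proof (rule walk_hom_natural[OF frac frac comp walk_hom_id _ _ _ w])
    fix x assume x: "x \<in> elems E"
    show "([], x) \<in> walks E x x" by (rule walks_id[OF x])
    have "down (up (gen_walk E x)) = wcomp (down (gen_walk C (top x))) (down (link x))"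
      unfolding up_gen[OF x]
      by (rule walk_homD(3)[OF walk_hom_down C.walks_gen[OF top_elems[OF x]] walks_link[OF x]])
    also have "\<dots> = gen_walk E x"
      by (auto simp: down_link down_gen wcomp_def) (auto simp: top_def split: if_splits)
    finally show "wcomp ([], act E 1 x) (down (up (gen_walk E x))) \<approx> wcomp (gen_walk E x) ([], x)"
      using hrefl[OF walks_gen[OF x]] wcomp_id_right[OF walks_gen[OF x]] by simp
    fix y assume y: "y \<in> elems E" "pclass E y = pclass E x"
    let ?x0 = "lab (pclass E x) 1"
    have X: "pclass E x \<in> polys E" using pclass_in_polys[OF x] .
    have x0: "?x0 \<in> elems E" "pclass E ?x0 = pclass E x"
      using lab_elems[OF X, of 1] pclass_lab[OF X, of 1] card_poly[OF X] by simp_all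
    note sx = walks_spine[OF x] and sy = walks_spine[OF y(1), unfolded y(2)]
    note ix = C.winv[OF sx]
    have dsx: "down (spine x) \<in> walks E ?x0 x" and dsy: "down (spine y) \<in> walks E ?x0 y"
      and dix: "down (winv C (spine x)) \<in> walks E x ?x0"
      using walk_homD(1)[OF walk_hom_down sx] walk_homD(1)[OF walk_hom_down sy]
        walk_homD(1)[OF walk_hom_down ix(1)] by simp_all
    have txy: "tau_walk x y \<in> walks E y x" and tyx: "tau_walk y x \<in> walks E x y"
      using x y by (simp_all add: walks_tau)
    \<comment> \<open>The image under \<open>down\<close> of the chosen inverse of
      \<open>spine x\<close> has no explicit form. Instead, the triangle of the two spine images and
      a \<tau> step is established here and then inverted along \<open>spine x\<close> and
      \<tau>.\<close>
    have "wcomp (tau_walk x y) (down (spine y)) \<approx> wcomp (tau_walk x y) (tau_walk y ?x0)"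
      using hcong_left[OF down_spine[OF y(1)] txy] dsy y(2) by simp
    also have "\<dots> \<approx> tau_walk x ?x0"
      by (rule homotopic.h2[OF x0(1) y(1) x]) (use x0 y in simp_all)
    also have "\<dots> \<approx> down (spine x)" by (rule homotopic.sym[OF down_spine[OF x]])
    finally have sq: "wcomp ([], x) (down (spine x)) \<approx> wcomp (tau_walk x y) (down (spine y))"
      using homotopic.sym by simp
    have "wcomp (tau_walk y x) (tau_walk x y) \<approx> tau_walk y y"
      by (rule homotopic.h2[OF y(1) x y(1)]) (use y in simp_all)
    also have "\<dots> \<approx> ([], y)" by (rule homotopic.h1_tau[OF y(1)])
    finally have tt: "wcomp (tau_walk y x) (tau_walk x y) \<approx> ([], y)" .
    have "wcomp (down (spine x)) (down (winv C (spine x))) \<approx> ([], x)"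
      using walk_homD(4)[OF walk_hom_down ix(3)] walk_homD(3)[OF walk_hom_down sx ix(1)]
        walk_homD(2)[OF walk_hom_down Inl_elems[OF x]] by simp
    from inverse_square[OF sq dsx txy dsy walks_id[OF x] dix tyx this tt]
    have "wcomp (down (spine y)) (down (winv C (spine x))) \<approx> wcomp (tau_walk y x) ([], x)" .
    then show "wcomp ([], y) (down (up (tau_walk y x))) \<approx> wcomp (tau_walk y x) ([], x)"
      using walk_homD(3)[OF walk_hom_down sy ix(1)] up_tau[OF x y] by simp
  qed
  then show ?thesis using wcomp_id_right[OF w] by simp
qed

text \<open>These paths form the natural isomorphism from \<open>up \<circ> down\<close> to the identity of \<open>\<Pi>(C, C)\<close>.\<close>

definition ascent :: "'a + 'a \<Rightarrow> ('a + 'a) walk" where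
  "ascent c = (case c of Inl x \<Rightarrow> ([], Inl x) | Inr x \<Rightarrow> gen_walk C (Inl x))"

lemma ascent_Inl [simp]: "ascent (Inl x) = ([], Inl x)"
  and ascent_top [simp]: "ascent (top x) = link x"
  by (simp_all add: ascent_def top_def link_def)

lemma walks_ascent:
  assumes "c \<in> elems C"
  shows "ascent c \<in> walks C (Inl (base c)) c"
  using assms by (cases rule: elems_C_cases) (auto simp: walks_id walks_link Inl_elems primed_elems)

text \<open>Stated for all of C so that the induction may pass through primed elements. At old
  elements \<open>ascent\<close> is trivial, and the square says that \<open>up (down w)\<close> is
  homotopic to \<open>w\<close>.\<close>

lemma up_down:
  assumes w: "w \<in> walks C c c'"
  shows "C.hom (wcomp (ascent c') (up (down w))) (wcomp w (ascent c))"
proof -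
  have comp: "walk_hom C C (\<lambda>c. Inl (base c)) (\<lambda>w. up (down w))"
    using walk_hom_comp[OF walk_hom_down walk_hom_up] by simp
  show ?thesis
  proof (rule walk_hom_natural[OF C.frac C.frac comp walk_hom_id walks_ascent _ _ w])
    fix c assume c: "c \<in> elems C"
    then show "C.hom (wcomp (ascent (act C 1 c)) (up (down (gen_walk C c)))) (wcomp (gen_walk C c) (ascent c))"
    proof (cases rule: elems_C_cases)
      \<comment> \<open>\<open>down\<close> collapses the step from e to e', while
        \<open>ascent\<close> at e' is this very step; both sides of the square reduce to
        it.\<close>
      case (primed x)
      note g = C.walks_gen[OF Inl_elems[OF primed_elems[OF primed(1)]]]
      have "ascent (act C 1 (Inl x)) = gen_walk C (Inl x)"
        using act_C_primed[OF primed(1)] by (simp add: ascent_def)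
      moreover have "up (down (gen_walk C (Inl x))) = ([], Inl x)"
        using primed(1) by (simp add: down_gen) (simp add: up_def)
      ultimately show ?thesis using primed(2) C.hrefl[OF g] wcomp_id_right[OF g] by simp
    next
      case (top x)
      have "down (gen_walk C (top x)) = gen_walk E x"
        by (auto simp: down_gen) (auto simp: top_def split: if_splits)
      then show ?thesis
        using top up_gen[OF top(1)] C.hrefl[OF walks_gen_link[OF top(1)]] by (simp add: act_C_top)
    qed
    fix c' assume c': "c' \<in> elems C" "pclass C c' = pclass C c"
    \<comment> \<open>The spine of e_{i+1} is the spine of e_i followed by one link and one rung.
      The common part cancels against its inverse, leaving the rung after \<open>ascent\<close> of
      its lower end.\<close>
    have rung: "C.hom (wcomp (ascent (Inl (lab X (Suc i)))) (up (down (tau_walk (Inl (lab X (Suc i))) (top (lab X i))))))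
        (wcomp (tau_walk (Inl (lab X (Suc i))) (top (lab X i))) (ascent (top (lab X i))))"
      if X: "X \<in> polys E" "1 \<le> i" "i < card X" for X i
    proof -
      let ?x = "lab X i" and ?y = "lab X (Suc i)"
      let ?t = "tau_walk (Inl ?y) (top ?x)"
      have x: "?x \<in> elems E" and y: "?y \<in> elems E" and p: "pclass E ?y = pclass E ?x"
        using X lab_elems[OF X(1)] pclass_lab[OF X(1)] by simp_all
      obtain n where n: "i = Suc n" using X(2) by (cases i) auto
      have spine: "spine ?y = wcomp (wcomp ?t (link ?x)) (spine ?x)"
        using spine_lab[OF X(1), of "Suc n"] spine_lab[OF X(1), of n] X(3) n by simp
      note s = walks_spine[OF x]
      note i = C.winv[OF s] and t = walks_rung[OF X] and l = walks_link[OF x]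
      have "up (down ?t) = wcomp (spine ?y) (winv C (spine ?x))"
        by (simp add: down_tau up_tau[OF x y p])
      also have "\<dots> = wcomp (wcomp ?t (link ?x)) (wcomp (spine ?x) (winv C (spine ?x)))"
        by (simp add: spine wcomp_assoc)
      also have "C.hom \<dots> (wcomp (wcomp ?t (link ?x)) ([], Inl ?x))"
        by (rule C.hcong_left[OF i(3)]) (rule walks_wcomp t l s i)+
      finally show ?thesis using wcomp_id_right[OF walks_wcomp[OF t l]] by simp
    qed
    show "C.hom (wcomp (ascent c') (up (down (tau_walk c' c)))) (wcomp (tau_walk c' c) (ascent c))"
      using c c'
    proof (cases rule: pclass_C_cases)
      case eq
      note x = base_elems[OF c] and a = walks_ascent[OF c]
      have "up (down (tau_walk c c)) = wcomp (spine (base c)) (winv C (spine (base c)))"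
        by (simp add: down_tau up_tau[OF x x])
      then have "C.hom (wcomp (ascent c) (up (down (tau_walk c c)))) (wcomp (ascent c) ([], Inl (base c)))"
        using C.hcong_left[OF C.winv(3)[OF walks_spine[OF x]] a walks_spines[OF x x]] by simp
      also have "wcomp (ascent c) ([], Inl (base c)) = wcomp ([], c) (ascent c)"
        using wcomp_id_right[OF a] by simp
      also have "C.hom \<dots> (wcomp (tau_walk c c) (ascent c))"
        by (rule C.hcong_right[OF homotopic.sym[OF homotopic.h1_tau[OF c]] walks_id[OF c] a])
      finally show ?thesis unfolding eq .
    next
      case (up X i)
      show ?thesis unfolding up(4,5) by (rule rung[OF up(1-3)])
    next
      \<comment> \<open>A rung descended is inverse to the same rung climbed, so its square comes
        from \<open>rung\<close> by inversion.\<close>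
      case (down X i)
      let ?a = "tau_walk c c'" and ?a' = "tau_walk c' c"
      have w: "?a \<in> walks C c' c" "?a' \<in> walks C c c'" using c c' by (simp_all add: walks_tau)
      have inv: "C.hom (wcomp ?a ?a') ([], c)"
        by (rule homotopic.trans[OF homotopic.h2[OF c c'(1) c c'(2) c'(2)[symmetric]] homotopic.h1_tau[OF c]])
      have inv': "C.hom (wcomp ?a' ?a) ([], c')"
        by (rule homotopic.trans[OF homotopic.h2[OF c'(1) c c'(1) c'(2)[symmetric] c'(2)]
            homotopic.h1_tau[OF c'(1)]])
      show ?thesis
      proof (rule walk_hom_square[OF C.frac comp walk_hom_id _ w(1) _ _ w(2) inv inv'])
        show "C.hom (wcomp (ascent c) (up (down ?a))) (wcomp ?a (ascent c'))"
          unfolding down(4,5) by (rule rung[OF down(1-3)])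
      qed (use walks_ascent c c' in auto)
    qed
  qed
qed

end


section \<open>Functors and isomorphisms\<close>

text \<open>The union avoids choosing a representative: for a homotopy invariant \<open>A\<close>
  all its terms are the same class.\<close>

definition class_map :: "'b fbc \<Rightarrow> ('a walk \<Rightarrow> 'b walk) \<Rightarrow> 'a walk set \<Rightarrow> 'b walk set" where
  "class_map F A U = (\<Union>u\<in>U. hclass F (A u))"

context fbc
begin

lemma hclass_eqI: "u \<approx> v \<Longrightarrow> hclass E u = hclass E v"
  using hclass_eq_iff homotopic_walks[OF frac] by blast

lemma hcomp_walks:
  "u \<in> walks E y z \<Longrightarrow> v \<in> walks E x y \<Longrightarrow> hcomp E (hclass E u) (hclass E v) = hclass E (wcomp u v)"
  by (rule hcomp_hclass[OF frac]) (auto simp: walks_def)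

end

lemma class_map_hclass:
  assumes F: "frac_brauer_config F" and w: "w \<in> walks E x y"
    and A: "\<And>v. homotopic E w v \<Longrightarrow> homotopic F (A w) (A v)"
  shows "class_map F A (hclass E w) = hclass F (A w)"
proof -
  interpret F: fbc F by standard (rule F)
  have "hclass F (A v) = hclass F (A w)" if "v \<in> hclass E w" for v
    using F.hclass_eqI[OF A] that by (simp add: hclass_def)
  moreover have "w \<in> hclass E w" using w by (simp add: hclass_def walks_def homotopic.refl)
  ultimately show ?thesis unfolding class_map_def by blast
qed

lemma is_functor_class_map:
  assumes E: "frac_brauer_config E" and F: "frac_brauer_config F" and hom: "walk_hom E F ob A"
    and S: "S \<subseteq> elems E" "ob ` S \<subseteq> T"
  shows "is_functor (fund_groupoid E S) (fund_groupoid F T) ob (class_map F A)"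
proof -
  interpret E: fbc E by standard (rule E)
  interpret F: fbc F by standard (rule F)
  have cm: "class_map F A (hclass E w) = hclass F (A w)" if "w \<in> walks E x y" for w x y
    by (rule class_map_hclass[OF F that]) (rule walk_homD(4)[OF hom])
  show ?thesis
    unfolding is_functor_def fund_groupoid_def groupoid_data.simps
  proof (intro conjI ballI)
    fix x assume x: "x \<in> S"
    then show "ob x \<in> T" using S(2) by blast
    show "class_map F A (hclass E ([], x)) = hclass F ([], ob x)"
      using cm[OF walks_id[of x E]] walk_homD(2)[OF hom, of x] x S(1) by auto
  next
    fix x y f assume "f \<in> hclass E ` walks E x y"
    then show "class_map F A f \<in> hclass F ` walks F (ob x) (ob y)"
      using cm walk_homD(1)[OF hom] by auto
  next
    fix x y z f g assume "g \<in> hclass E ` walks E x y" "f \<in> hclass E ` walks E y z"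
    then obtain u v where v: "v \<in> walks E x y" "g = hclass E v" and u: "u \<in> walks E y z" "f = hclass E u"
      by blast
    show "class_map F A (hcomp E f g) = hcomp F (class_map F A f) (class_map F A g)"
      using cm[OF u(1)] cm[OF v(1)] cm[OF walks_wcomp[OF u(1) v(1)]] E.hcomp_walks[OF u(1) v(1)]
        F.hcomp_walks[OF walk_homD(1)[OF hom u(1)] walk_homD(1)[OF hom v(1)]]
        walk_homD(3)[OF hom u(1) v(1)] u(2) v(2)
      by simp
  qed
qed

text \<open>Conjugation by a path is multiplicative only after a cancellation in the middle, so it
  is no \<open>walk_hom\<close>. The criterion therefore asks for multiplicativity up to homotopy,
  and only on loops at the base point.\<close>

lemma fund_group_isoI:
  assumes E: "frac_brauer_config E" and F: "frac_brauer_config F"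
    and A: "\<And>u. u \<in> walks E x x \<Longrightarrow> A u \<in> walks F y y"
    and B: "\<And>v. v \<in> walks F y y \<Longrightarrow> B v \<in> walks E x x"
    and A_cong: "\<And>u u'. u \<in> walks E x x \<Longrightarrow> homotopic E u u' \<Longrightarrow> homotopic F (A u) (A u')"
    and B_cong: "\<And>v v'. v \<in> walks F y y \<Longrightarrow> homotopic F v v' \<Longrightarrow> homotopic E (B v) (B v')"
    and A_comp: "\<And>u v. u \<in> walks E x x \<Longrightarrow> v \<in> walks E x x \<Longrightarrow>
      homotopic F (A (wcomp u v)) (wcomp (A u) (A v))"
    and BA: "\<And>u. u \<in> walks E x x \<Longrightarrow> homotopic E (B (A u)) u"
    and AB: "\<And>v. v \<in> walks F y y \<Longrightarrow> homotopic F (A (B v)) v"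
  shows "fund_group E x \<cong> fund_group F y"
proof -
  interpret E: fbc E by standard (rule E)
  interpret F: fbc F by standard (rule F)
  have cA: "class_map F A (hclass E u) = hclass F (A u)" if "u \<in> walks E x x" for u
    by (rule class_map_hclass[OF F that]) (rule A_cong[OF that])
  have cB: "class_map E B (hclass F v) = hclass E (B v)" if "v \<in> walks F y y" for v
    by (rule class_map_hclass[OF E that]) (rule B_cong[OF that])
  have "class_map F A \<in> iso (fund_group E x) (fund_group F y)"
  proof (rule isoI)
    show "class_map F A \<in> hom (fund_group E x) (fund_group F y)"
    proof (rule homI)
      fix f assume "f \<in> carrier (fund_group E x)"
      then show "class_map F A f \<in> carrier (fund_group F y)"
        using cA A by (auto simp: fund_group_def)
    next
      fix f g assume "f \<in> carrier (fund_group E x)" "g \<in> carrier (fund_group E x)"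
      then obtain u v where u: "u \<in> walks E x x" "f = hclass E u" and v: "v \<in> walks E x x" "g = hclass E v"
        by (auto simp: fund_group_def)
      show "class_map F A (f \<otimes>\<^bsub>fund_group E x\<^esub> g) =
          class_map F A f \<otimes>\<^bsub>fund_group F y\<^esub> class_map F A g"
        using cA[OF u(1)] cA[OF v(1)] cA[OF walks_wcomp[OF u(1) v(1)]]
          E.hcomp_walks[OF u(1) v(1)] F.hcomp_walks[OF A[OF u(1)] A[OF v(1)]]
          F.hclass_eqI[OF A_comp[OF u(1) v(1)]] u(2) v(2)
        by (simp add: fund_group_def)
    qed
    show "bij_betw (class_map F A) (carrier (fund_group E x)) (carrier (fund_group F y))"
      by (rule bij_betw_byWitness[where f' = "class_map E B"])
        (auto simp: fund_group_def cA cB A B E.hclass_eqI[OF BA] F.hclass_eqI[OF AB])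
  qed
  then show ?thesis by (auto simp: is_iso_def)
qed

lemma (in fbc) fund_group_conj:
  assumes q: "q \<in> walks E x y"
  shows "fund_group E x \<cong> fund_group E y"
proof -
  \<comment> \<open>Stated for arbitrary opposite walks \<open>p\<close> and \<open>r\<close>, so
    that conjugation by \<open>q\<close> and by its inverse are both instances.\<close>
  have conj: "wcomp (wcomp p u) r \<in> walks E b b"
    and conj_cong: "u \<approx> u' \<Longrightarrow> wcomp (wcomp p u) r \<approx> wcomp (wcomp p u') r"
    and conj_conj: "wcomp r p \<approx> ([], a) \<Longrightarrow> wcomp (wcomp r (wcomp (wcomp p u) r)) p \<approx> u"
    and conj_comp: "wcomp r p \<approx> ([], a) \<Longrightarrow> v \<in> walks E a a \<Longrightarrow>
      wcomp (wcomp p (wcomp u v)) r \<approx> wcomp (wcomp (wcomp p u) r) (wcomp (wcomp p v) r)"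
    if w: "p \<in> walks E a b" "r \<in> walks E b a" "u \<in> walks E a a" for p r a b u u' v
  proof -
    show "wcomp (wcomp p u) r \<in> walks E b b" by (rule walks_wcomp w)+
    show "wcomp (wcomp p u) r \<approx> wcomp (wcomp p u') r" if "u \<approx> u'"
      by (rule hcong_right[OF hcong_left[OF that]]) (rule walks_wcomp w)+
    assume rp: "wcomp r p \<approx> ([], a)"
    have "wcomp (wcomp r (wcomp (wcomp p u) r)) p = wcomp (wcomp r p) (wcomp u (wcomp r p))"
      by (simp add: wcomp_assoc)
    also have "\<dots> \<approx> wcomp ([], a) (wcomp u ([], a))"
      by (rule hcong[OF rp hcong_left[OF rp]]) (rule walks_wcomp w)+
    finally show "wcomp (wcomp r (wcomp (wcomp p u) r)) p \<approx> u" using wcomp_id_right[OF w(3)] by simp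
    assume v: "v \<in> walks E a a"
    have "wcomp (wcomp (wcomp p u) r) (wcomp (wcomp p v) r) =
        wcomp (wcomp p u) (wcomp (wcomp r p) (wcomp v r))"
      by (simp add: wcomp_assoc)
    also have "\<dots> \<approx> wcomp (wcomp p u) (wcomp ([], a) (wcomp v r))"
      by (rule hcong_left[OF hcong_right[OF rp]]) (rule walks_wcomp w v)+
    finally have "wcomp (wcomp (wcomp p u) r) (wcomp (wcomp p v) r) \<approx> wcomp (wcomp p (wcomp u v)) r"
      by (simp add: wcomp_assoc)
    then show "wcomp (wcomp p (wcomp u v)) r \<approx> wcomp (wcomp (wcomp p u) r) (wcomp (wcomp p v) r)"
      by (rule homotopic.sym)
  qed
  note i = winv[OF q]
  show ?thesis
    by (rule fund_group_isoI[OF frac frac, where A = "\<lambda>u. wcomp (wcomp q u) (winv E q)"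
          and B = "\<lambda>v. wcomp (wcomp (winv E q) v) q"])
      (rule conj[OF q i(1)] conj[OF i(1) q] conj_cong[OF q i(1)] conj_cong[OF i(1) q]
          conj_comp[OF q i(1) _ i(2)] conj_conj[OF q i(1) _ i(2)] conj_conj[OF i(1) q _ i(3)] | assumption)+
qed

context labelled_brauer
begin

lemma isomorphic_groupoids_C:
  "isomorphic_groupoids (fund_groupoid E (elems E)) (fund_groupoid C (Inl ` elems E))"
  unfolding isomorphic_groupoids_def
proof (intro exI conjI ballI)
  show "is_functor (fund_groupoid E (elems E)) (fund_groupoid C (Inl ` elems E)) Inl (class_map C up)"
    by (rule is_functor_class_map[OF frac C.frac walk_hom_up]) auto
  show "is_functor (fund_groupoid C (Inl ` elems E)) (fund_groupoid E (elems E)) base (class_map E down)"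
    by (rule is_functor_class_map[OF C.frac frac walk_hom_down]) (auto simp: Inl_elems)
  have cu: "class_map C up (hclass E w) = hclass C (up w)" if "w \<in> walks E x y" for w x y
    by (rule class_map_hclass[OF C.frac that]) (rule walk_homD(4)[OF walk_hom_up])
  have cd: "class_map E down (hclass C w) = hclass E (down w)" if "w \<in> walks C c c'" for w c c'
    by (rule class_map_hclass[OF frac that]) (rule walk_homD(4)[OF walk_hom_down])
  show "base (Inl x) = x" for x by simp
  show "Inl (base c) = c" if "c \<in> obj (fund_groupoid C (Inl ` elems E))" for c
    using that by (auto simp: fund_groupoid_def)
  show "class_map E down (class_map C up f) = f"
    if f: "f \<in> hom_set (fund_groupoid E (elems E)) x y" for x y f
  proof -
    obtain u where u: "u \<in> walks E x y" "f = hclass E u" using f by (auto simp: fund_groupoid_def)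
    then show ?thesis
      using cu[OF u(1)] cd[OF walk_homD(1)[OF walk_hom_up u(1)]] hclass_eqI[OF down_up[OF u(1)]] by simp
  qed
  show "class_map C up (class_map E down f) = f"
    if f: "c \<in> obj (fund_groupoid C (Inl ` elems E))" "c' \<in> obj (fund_groupoid C (Inl ` elems E))"
      "f \<in> hom_set (fund_groupoid C (Inl ` elems E)) c c'" for c c' f
  proof -
    obtain x y where xy: "c = Inl x" "c' = Inl y" using f(1,2) by (auto simp: fund_groupoid_def)
    obtain u where u: "u \<in> walks C (Inl x) (Inl y)" "f = hclass C u"
      using f(3) xy by (auto simp: fund_groupoid_def)
    \<comment> \<open>Both ends are old elements, where \<open>ascent\<close> is trivial.\<close>
    have "C.hom (up (down u)) u" using up_down[OF u(1)] wcomp_id_right[OF u(1)] by simp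
    then show ?thesis
      using cd[OF u(1)] cu[OF walk_homD(1)[OF walk_hom_down u(1)]] C.hclass_eqI u(2) by simp
  qed
qed

lemma fund_group_C:
  "fund_group E x \<cong> fund_group C (Inl x)"
proof (rule fund_group_isoI[OF frac C.frac, where A = up and B = down])
  show "up u \<in> walks C (Inl x) (Inl x)" if "u \<in> walks E x x" for u
    using walk_homD(1)[OF walk_hom_up that] .
  show "down v \<in> walks E x x" if "v \<in> walks C (Inl x) (Inl x)" for v
    using walk_homD(1)[OF walk_hom_down that] by simp
  show "C.hom (up u) (up u')" if "u \<approx> u'" for u u' using walk_homD(4)[OF walk_hom_up that] .
  show "down v \<approx> down v'" if "C.hom v v'" for v v' using walk_homD(4)[OF walk_hom_down that] .
  show "C.hom (up (wcomp u v)) (wcomp (up u) (up v))" if "u \<in> walks E x x" "v \<in> walks E x x" for u v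
    using walk_homD(3)[OF walk_hom_up that]
      C.hrefl[OF walk_homD(1)[OF walk_hom_up walks_wcomp[OF that]]] by simp
  show "down (up u) \<approx> u" if "u \<in> walks E x x" for u by (rule down_up[OF that])
  show "C.hom (up (down v)) v" if "v \<in> walks C (Inl x) (Inl x)" for v
    using up_down[OF that] wcomp_id_right[OF that] by simp
qed

lemma connected_C:
  assumes "fbc_connected E"
  shows "fbc_connected C"
  unfolding fbc_connected_def
proof (intro ballI)
  fix c c' assume c: "c \<in> elems C" "c' \<in> elems C"
  then obtain w where "w \<in> walks E (base c) (base c')"
    using assms base_elems unfolding fbc_connected_def by blast
  \<comment> \<open>Descend from \<open>c\<close> to the old element below it, follow the lift of
    \<open>w\<close>, and ascend to \<open>c'\<close>.\<close>
  note walks_wcomp[OF walks_wcomp[OF walks_ascent[OF c(2)] walk_homD(1)[OF walk_hom_up this]]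
      C.winv(1)[OF walks_ascent[OF c(1)]]]
  then show "walks C c c' \<noteq> {}" by blast
qed

end

theorem corollary6p5:
  fixes E :: "'a fbc" and lab :: "'a set \<Rightarrow> nat \<Rightarrow> 'a" and C :: "('a + 'a) fbc"
  assumes "brauer_config E"
    and "labelling E lab"
    and "C = assoc_graph E lab"
  shows "isomorphic_groupoids (fund_groupoid E (elems E)) (fund_groupoid C (Inl ` elems E)) \<and>
    (fbc_connected E \<longrightarrow>
       fbc_connected C \<and>
       (\<forall>x\<in>elems E. \<forall>y\<in>elems C. fund_group E x \<cong> fund_group C y))"
proof -
  \<comment> \<open>Any bijection serves on the 2-gons; larger polygons keep their labels, so the
    graph is unchanged by \<open>assoc_graph_cong\<close>.\<close>
  define lab' where "lab' = (\<lambda>X. if 3 \<le> card X then lab X else (SOME f. bij_betw f {1..card X} X))"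
  have "bij_betw (lab' X) {1..card X} X" if X: "X \<in> polys E" for X
  proof (cases "3 \<le> card X")
    case True
    then show ?thesis using assms(2) X by (simp add: labelling_def lab'_def)
  next
    case False
    have "X \<subseteq> elems E"
      using assms(1) X by (auto simp: brauer_config_def dest!: frac_dest(2) partition_onD1)
    then have "finite X" using assms(1) finite_subset by (auto simp: brauer_config_def)
    then show ?thesis using False someI_ex[OF ex_bij_betw_nat_finite_1] by (simp add: lab'_def)
  qed
  then interpret L: labelled_brauer E lab'
    by unfold_locales (use assms(1) in auto)
  have C: "assoc_graph E lab' = C"
    unfolding assms(3) by (rule assoc_graph_cong) (simp add: lab'_def)
  \<comment> \<open>The functors compare loops at \<open>x\<close> with loops at
    \<open>Inl x\<close>; a path in C then moves the base point to any \<open>y\<close>, primed or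
    not.\<close>
  have "fund_group E x \<cong> fund_group C y"
    if con: "fbc_connected C" and x: "x \<in> elems E" and y: "y \<in> elems C" for x y
  proof -
    have "Inl x \<in> elems C" using L.Inl_elems[OF x] by (simp add: C)
    then obtain q where "q \<in> walks C (Inl x) y" using con y unfolding fbc_connected_def by blast
    then show ?thesis
      using iso_trans[OF L.fund_group_C[of x]] L.C.fund_group_conj[of q "Inl x" y] by (simp add: C)
  qed
  then show ?thesis using L.isomorphic_groupoids_C L.connected_C by (simp add: C)
qed

end
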